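(* Let $m,n\ge 0$ with $p=2m+n>1$, and let $\mathcal{P}$ be the family of simple planar graphs. Then $$3p^2+p+1\le \omega_{r(m,n)}(\mathcal{P})\le 42p^2+8.$$
   Context: An $(m,n)$-colored mixed graph $G$ is obtained from a simple graph $U(G)$ (its underlying graph) by giving each edge either an orientation and one of $m$ arc colors (an arc) or leaving it unoriented with one of $n$ edge colors (an edge). For adjacent $u,v$, the adjacency type of $uv$ is "arc $u\to v$ of color $i$", "arc $v\to u$ of color $i$", or "edge of color $j$"; $uv$ and $wx$ have the same adjacency type if both are arcs $u\to v$, $w\to x$ of the same color, or both arcs $v\to u$, $x\to w$ of the same color, or both edges of the same color. A colored homomorphism $f:G\to H$ between $(m,n)$-colored mixed graphs (with simple underlying graphs) is a vertex map such that for each adjacent pair $uv$ of $G$, $f(u)f(v)$ is adjacent in $H$ with the same adjacency type. $R\subseteq V(G)$ is a relative $(m,n)$-clique if no two distinct vertices of $R$ have the same image under any colored homomorphism of $G$. $\omega_{r(m,n)}(G)$ is the maximum size of a relative $(m,n)$-clique of $G$; for a family $\mathcal{F}$ of simple graphs, $\omega_{r(m,n)}(\mathcal{F})$ is the maximum of $\omega_{r(m,n)}(G)$ over all $(m,n)$-colored mixed graphs $G$ with $U(G)\in\mathcal{F}$. A 2-path $uvw$ is special if $uv$ and $vw$ do not have the same adjacency type; it is known that two distinct vertices can never be identified by a colored homomorphism iff they are adjacent or joined by a special 2-path. *)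

theory Defs
  imports "HOL-Analysis.Analysis" "HOL-Library.Extended_Nat"
begin

text \<open>Adjacency type of an ordered adjacent pair (u,v):
  Fwd i = arc u -> v of colour i, Bwd i = arc v -> u of colour i, Edg j = edge of colour j.\<close>
datatype adjtype = Fwd nat | Bwd nat | Edg nat

fun flip_adj :: "adjtype \<Rightarrow> adjtype" where
  "flip_adj (Fwd i) = Bwd i"
| "flip_adj (Bwd i) = Fwd i"
| "flip_adj (Edg j) = Edg j"

text \<open>A mixed graph on vertex set V (vertices are natural numbers) is given by a labelling
  of ordered pairs; None means non-adjacent.\<close>
record mgraph =
  verts :: "nat set"
  lab :: "nat \<Rightarrow> nat \<Rightarrow> adjtype option"

definition colored_mixed_graph :: "nat \<Rightarrow> nat \<Rightarrow> mgraph \<Rightarrow> bool" where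
  "colored_mixed_graph m n G \<longleftrightarrow>
     finite (verts G) \<and>
     (\<forall>u v. lab G u v \<noteq> None \<longrightarrow> u \<in> verts G \<and> v \<in> verts G \<and> u \<noteq> v) \<and>
     (\<forall>u v. lab G v u = map_option flip_adj (lab G u v)) \<and>
     (\<forall>u v i. lab G u v = Some (Fwd i) \<longrightarrow> i < m) \<and>
     (\<forall>u v j. lab G u v = Some (Edg j) \<longrightarrow> j < n)"

definition underlying_edges :: "mgraph \<Rightarrow> nat set set" where
  "underlying_edges G = {{u, v} | u v. lab G u v \<noteq> None}"

definition colored_hom :: "mgraph \<Rightarrow> mgraph \<Rightarrow> (nat \<Rightarrow> nat) \<Rightarrow> bool" where
  "colored_hom G H f \<longleftrightarrow>
     f ` verts G \<subseteq> verts H \<and>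
     (\<forall>u v t. lab G u v = Some t \<longrightarrow> lab H (f u) (f v) = Some t)"

definition relative_clique :: "nat \<Rightarrow> nat \<Rightarrow> mgraph \<Rightarrow> nat set \<Rightarrow> bool" where
  "relative_clique m n G R \<longleftrightarrow>
     R \<subseteq> verts G \<and>
     (\<forall>H f. colored_mixed_graph m n H \<and> colored_hom G H f \<longrightarrow> inj_on f R)"

definition omega_r :: "nat \<Rightarrow> nat \<Rightarrow> mgraph \<Rightarrow> nat" where
  "omega_r m n G = Max {card R | R. relative_clique m n G R}"

definition simple_graph :: "nat set \<Rightarrow> nat set set \<Rightarrow> bool" where
  "simple_graph V E \<longleftrightarrow> finite V \<and> (\<forall>e\<in>E. \<exists>u v. u \<noteq> v \<and> u \<in> V \<and> v \<in> V \<and> e = {u, v})"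

definition planar :: "nat set \<Rightarrow> nat set set \<Rightarrow> bool" where
  "planar V E \<longleftrightarrow> simple_graph V E \<and>
     (\<exists>(pos :: nat \<Rightarrow> real^2) (\<gamma> :: nat set \<Rightarrow> real \<Rightarrow> real^2).
        inj_on pos V \<and>
        (\<forall>e\<in>E. arc (\<gamma> e) \<and> {pathstart (\<gamma> e), pathfinish (\<gamma> e)} = pos ` e \<and>
                 path_image (\<gamma> e) \<inter> pos ` V \<subseteq> pos ` e) \<and>
        (\<forall>e\<in>E. \<forall>e'\<in>E. e \<noteq> e' \<longrightarrow>
                 path_image (\<gamma> e) \<inter> path_image (\<gamma> e') \<subseteq> pos ` (e \<inter> e')))"

definition omega_r_planar :: "nat \<Rightarrow> nat \<Rightarrow> enat" where
  "omega_r_planar m n =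
     (SUP G \<in> {G. colored_mixed_graph m n G \<and> planar (verts G) (underlying_edges G)}.
        enat (omega_r m n G))"

end

theory Submission
  imports Defs
begin

text \<open>
  Upper bound. The only topological input is that a planar graph has no \<open>K\<^sub>3\<^sub>,\<^sub>3\<close> minor. Two distinct
  vertices of a relative clique \<open>R\<close> are adjacent or are the ends of a special 2-path. Excluding
  \<open>K\<^sub>3\<^sub>,\<^sub>3\<close> forces at most \<open>5 p + 7\<close> vertices of \<open>R\<close> to have the same adjacency type towards a fixed
  vertex, so a vertex with \<open>d\<close> neighbours in \<open>R\<close> joins at most \<open>d q\<close> ordered pairs, where
  \<open>q = (p - 1) (5 p + 7)\<close>. A graph without \<open>K\<^sub>3\<^sub>,\<^sub>3\<close> minor on \<open>N\<close> vertices has fewer than \<open>4 N\<close>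
  edges; hence the vertices of \<open>R\<close> together with the outer vertices having at least five neighbours
  in \<open>R\<close> join at most \<open>8 q |R|\<close> ordered pairs. An outer vertex with at most four neighbours is
  replaced by cliques on at most three of them (a Y-Delta move, which creates no \<open>K\<^sub>3\<^sub>,\<^sub>3\<close> minor), and
  three such replacements account for the remaining \<open>24 |R|\<close> ordered pairs. Comparing with
  \<open>|R| (|R| - 1)\<close> gives \<open>|R| \<le> 8 q + 25 \<le> 42 p\<^sup>2 + 8\<close>.

  Lower bound. A vertex joined to everything, over \<open>p\<close> disjoint fans with \<open>3 p + 1\<close> vertices each:
  the fans are outerplanar, so they can be drawn above a line with their vertices on it and the apex
  below.
\<close>

section \<open>A topological obstruction to drawing \<open>K\<^sub>3\<^sub>,\<^sub>3\<close>\<close>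

lemma simple_closed_curve_side_avoiding:
  fixes c :: "real \<Rightarrow> complex"
  assumes c: "simple_path c" "pathfinish c = pathstart c" and q: "q \<notin> path_image c"
  obtains W where "W \<noteq> {}" "connected W" "W \<inter> path_image c = {}" "path_image c \<subseteq> closure W"
    "\<And>S. connected S \<Longrightarrow> q \<in> S \<Longrightarrow> S \<inter> path_image c = {} \<Longrightarrow> S \<inter> W = {}"
proof -
  let ?I = "inside (path_image c)" and ?O = "outside (path_image c)"
  note sides = Jordan_inside_outside[OF c]
  obtain W W' where W: "W \<noteq> {}" "open W" "connected W" "frontier W = path_image c"
    "open W'" "q \<in> W'"
    and disjoint: "W \<inter> W' = {}" and cover: "W \<union> W' = - path_image c"
  proof (cases "q \<in> ?I")
    case True
    show ?thesis by (rule that[of ?O ?I]) (use sides True in blast)+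
  next
    case False
    show ?thesis by (rule that[of ?I ?O]) (use sides False q in blast)+
  qed
  have "S \<inter> W = {}" if S: "connected S" "q \<in> S" "S \<inter> path_image c = {}" for S
    using connectedD[OF S(1) \<open>open W\<close> \<open>open W'\<close>] S disjoint cover \<open>q \<in> W'\<close> by blast
  moreover have "path_image c \<subseteq> closure W"
    using W(4) by (auto simp: frontier_def)
  ultimately show thesis
    using that W cover by blast
qed

lemma theta_curve_side_avoiding:
  fixes c :: "3 \<Rightarrow> real \<Rightarrow> complex"
  assumes c: "\<And>i. arc (c i)" "\<And>i. pathstart (c i) = a" "\<And>i. pathfinish (c i) = b"
    and meet: "\<And>i j. i \<noteq> j \<Longrightarrow> path_image (c i) \<inter> path_image (c j) = {a, b}"
    and Q: "connected Q" "q \<in> Q" "Q \<inter> path_image (c 3) \<noteq> {}"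
      "Q \<inter> path_image (c 1) = {}" "Q \<inter> path_image (c 2) = {}"
  obtains W where "W \<noteq> {}" "connected W" "\<And>i. W \<inter> path_image (c i) = {}"
    "path_image (c 1) \<union> path_image (c 2) \<subseteq> closure W"
    "\<And>S. connected S \<Longrightarrow> q \<in> S \<Longrightarrow> S \<inter> (path_image (c 1) \<union> path_image (c 2)) = {} \<Longrightarrow> S \<inter> W = {}"
proof -
  let ?C = "\<lambda>i. path_image (c i)"
  define loop where "loop = c 1 +++ reversepath (c 2)"
  have image: "path_image loop = ?C 1 \<union> ?C 2"
    unfolding loop_def using c by (simp add: path_image_join)
  have "simple_path loop"
    unfolding loop_def by (rule simple_path_join_loop) (use c meet in \<open>auto simp: arc_reversepath\<close>)
  moreover have "pathfinish loop = pathstart loop"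
    unfolding loop_def using c by simp
  moreover have "q \<notin> path_image loop"
    using image Q by auto
  ultimately obtain W where W: "W \<noteq> {}" "connected W" "W \<inter> path_image loop = {}"
    "path_image loop \<subseteq> closure W"
    and side: "\<And>S. connected S \<Longrightarrow> q \<in> S \<Longrightarrow> S \<inter> path_image loop = {} \<Longrightarrow> S \<inter> W = {}"
    using simple_closed_curve_side_avoiding[of loop q] by blast
  have ends: "{a, b} \<subseteq> ?C 1"
    using c pathstart_in_path_image[of "c 1"] pathfinish_in_path_image[of "c 1"] by simp
  have "connected (?C 3 - {a, b})"
    using connected_simple_path_endless[of "c 3"] c by (simp add: arc_imp_simple_path)
  then have "connected (Q \<union> (?C 3 - {a, b}))"
    by (rule connected_Un[OF Q(1)]) (use Q ends in blast)
  then have "(Q \<union> (?C 3 - {a, b})) \<inter> W = {}"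
    by (rule side) (use Q meet[of 3 1] meet[of 3 2] image in auto)
  then have "W \<inter> ?C i = {}" for i
    using W(3) image ends exhaust_3[of i] by blast
  then show thesis
    using that W side unfolding image by blast
qed

text \<open>A point \<open>x\<close> on the side of \<open>c 1 \<union> c 2\<close> avoiding \<open>q\<close> is not separated from \<open>q\<close> by \<open>c 1 \<union> c 3\<close>
  or by \<open>c 2 \<union> c 3\<close>. These meet in the connected set \<open>c 3\<close>, so Janiszewski's theorem contradicts
  the choice of \<open>x\<close>.\<close>

lemma theta_curve_obstruction:
  fixes c :: "3 \<Rightarrow> real \<Rightarrow> complex" and Q :: "3 \<Rightarrow> complex set"
  assumes c: "\<And>i. arc (c i)" "\<And>i. pathstart (c i) = a" "\<And>i. pathfinish (c i) = b"
    and meet: "\<And>i j. i \<noteq> j \<Longrightarrow> path_image (c i) \<inter> path_image (c j) = {a, b}"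
    and Q: "\<And>i. connected (Q i)" "\<And>i. q \<in> Q i" "\<And>i. Q i \<inter> path_image (c i) \<noteq> {}"
    and Q_avoids: "\<And>i j. i \<noteq> j \<Longrightarrow> Q i \<inter> path_image (c j) = {}"
  shows False
proof -
  let ?C = "\<lambda>i. path_image (c i)"
  obtain W where W: "W \<noteq> {}" "connected W" "\<And>i. W \<inter> ?C i = {}" "?C 1 \<union> ?C 2 \<subseteq> closure W"
    and side: "\<And>S. connected S \<Longrightarrow> q \<in> S \<Longrightarrow> S \<inter> (?C 1 \<union> ?C 2) = {} \<Longrightarrow> S \<inter> W = {}"
    using theta_curve_side_avoiding[of c a b "Q 3" q] c meet Q[of 3] Q_avoids[of 3] by auto
  obtain x where x: "x \<in> W" using W(1) by blast
  have linked: "connected_component (- (?C k \<union> ?C 3)) x q"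
    if kl: "k = 1 \<and> l = 2 \<or> k = 2 \<and> l = 1" for k l :: 3
  proof -
    let ?leg = "?C l - {a, b}"
    have distinct: "l \<noteq> k" "l \<noteq> 3" "k \<noteq> 3" using kl by auto
    have "{a, b} \<subseteq> ?C k"
      using c pathstart_in_path_image[of "c k"] pathfinish_in_path_image[of "c k"] by simp
    then have "Q l \<inter> ?leg \<noteq> {}"
      using Q(3)[of l] Q_avoids[OF distinct(1)] by blast
    moreover have "connected (W \<union> ?leg)"
      by (rule connected_intermediate_closure[OF W(2)]) (use W(4) kl closure_subset[of W] in auto)
    ultimately have "connected (W \<union> ?leg \<union> Q l)"
      by (intro connected_Un[OF _ Q(1)]) auto
    moreover have "W \<union> ?leg \<union> Q l \<subseteq> - (?C k \<union> ?C 3)"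
      using W(3)[of k] W(3)[of 3] Q_avoids[OF distinct(1)] Q_avoids[OF distinct(2)]
        meet[OF distinct(1)] meet[OF distinct(2)]
      by blast
    ultimately show ?thesis
      unfolding connected_component_def using x Q(2) by blast
  qed
  have "(?C 1 \<union> ?C 3) \<inter> (?C 2 \<union> ?C 3) = ?C 3"
    using meet[of 1 2] meet[of 1 3] by auto
  then have "connected ((?C 1 \<union> ?C 3) \<inter> (?C 2 \<union> ?C 3))"
    using c by (simp add: connected_path_image arc_imp_path)
  moreover have "compact (?C 1 \<union> ?C 3)" "closed (?C 2 \<union> ?C 3)"
    using c by (auto simp: compact_Un compact_path_image arc_imp_path intro!: compact_imp_closed)
  ultimately have "connected_component (- ((?C 1 \<union> ?C 3) \<union> (?C 2 \<union> ?C 3))) x q"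
    using Janiszewski linked[of 1 2] linked[of 2 1] by blast
  then obtain S where "connected S" "S \<subseteq> - ((?C 1 \<union> ?C 3) \<union> (?C 2 \<union> ?C 3))" "x \<in> S" "q \<in> S"
    unfolding connected_component_def by blast
  with side[of S] x show False by blast
qed

lemma arc_split:
  fixes s :: "real \<Rightarrow> 'a::topological_space"
  assumes s: "arc s" and a: "a \<in> path_image s"
  obtains S T where "path_connected S" "path_connected T" "pathstart s \<in> S" "pathfinish s \<in> T"
    "S \<union> T = path_image s" "S \<inter> T = {a}"
proof -
  obtain v where v: "0 \<le> v" "v \<le> 1" "a = s v"
    using a by (auto simp: path_image_def)
  have cont: "continuous_on {0..1} s" and inj: "inj_on s {0..1}"
    using s by (auto simp: arc_def path_def)
  show thesis
  proof (rule that[of "s ` {0..v}" "s ` {v..1}"])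
    show "path_connected (s ` {0..v})" "path_connected (s ` {v..1})"
      using v by (auto intro!: path_connected_continuous_image convex_imp_path_connected
        continuous_on_subset[OF cont])
    show "pathstart s \<in> s ` {0..v}" "pathfinish s \<in> s ` {v..1}"
      using v by (auto simp: pathstart_def pathfinish_def)
    show "s ` {0..v} \<union> s ` {v..1} = path_image s"
      using v by (simp add: path_image_def ivl_disj_un_two_touch flip: image_Un)
    have "s ` {0..v} \<inter> s ` {v..1} = s ` ({0..v} \<inter> {v..1})"
      using v by (intro inj_on_image_Int[OF inj, symmetric]) auto
    also have "{0..v} \<inter> {v..1} = {v}"
      using v by auto
    finally show "s ` {0..v} \<inter> s ` {v..1} = {a}"
      using v by simp
  qed
qed

lemma path_connected_meeting_arc_once:
  fixes A :: "'a::real_normed_vector set"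
  assumes A: "path_connected A" and x: "x \<in> A" and s: "arc s" "path_image s \<subseteq> A"
  obtains a T where "path_connected T" "x \<in> T" "T \<subseteq> A" "T \<inter> path_image s = {a}"
proof (cases "x \<in> path_image s")
  case True
  then show ?thesis using that[of "{x}" x] x by simp
next
  case False
  obtain g where g: "path g" "path_image g \<subseteq> A" "pathstart g = x" "pathfinish g = pathstart s"
    using A x s pathstart_in_path_image[of s] unfolding path_connected_def by blast
  have "pathstart g \<in> closure (- path_image s)" "pathfinish g \<notin> - path_image s"
    using g False closure_subset[of "- path_image s"] pathstart_in_path_image[of s] by auto
  then obtain h where h: "path h" "pathstart h = x" "path_image h \<subseteq> path_image g"
    "path_image h - {pathfinish h} \<subseteq> interior (- path_image s)"
    "pathfinish h \<in> frontier (- path_image s)"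
    using exists_path_subpath_to_frontier[OF g(1)] unfolding g(3) by blast
  have "closed (path_image s)"
    using s closed_arc_image by blast
  then have "path_image h \<inter> path_image s = {pathfinish h}"
    using h(4,5) frontier_subset_closed[of "path_image s"] interior_subset
      pathfinish_in_path_image[of h]
    by fastforce
  then show ?thesis
    using that[of "path_image h" "pathfinish h"] h g pathstart_in_path_image[of h]
    by (simp add: path_connected_path_image subset_trans)
qed

lemma path_connected_tripod:
  fixes A :: "'a::banach set" and x :: "3 \<Rightarrow> 'a"
  assumes A: "path_connected A" and x: "\<And>i. x i \<in> A"
  obtains a T where "\<And>i. path_connected (T i)" "\<And>i. T i \<subseteq> A" "\<And>i. x i \<in> T i"
    "\<And>i j. i \<noteq> j \<Longrightarrow> T i \<inter> T j = {a}"
proof -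
  obtain a X Y Z where conn: "path_connected X" "path_connected Y" "path_connected Z"
    and sub: "X \<union> Y \<union> Z \<subseteq> A" and mem: "x 1 \<in> X" "x 2 \<in> Y" "x 3 \<in> Z"
    and meet: "X \<inter> Y = {a}" "X \<inter> Z = {a}" "Y \<inter> Z = {a}"
  proof (cases "x 1 = x 2")
    case True
    then show ?thesis
      by (intro that[of "{x 1}" "{x 2}" A "x 1"]) (use A x in auto)
  next
    case False
    then obtain s where s: "arc s" "path_image s \<subseteq> A" "pathstart s = x 1" "pathfinish s = x 2"
      using A x unfolding path_connected_arcwise by blast
    obtain a Z where Z: "path_connected Z" "x 3 \<in> Z" "Z \<subseteq> A" "Z \<inter> path_image s = {a}"
      by (rule path_connected_meeting_arc_once[OF A x[of 3] s(1,2)])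
    then have "a \<in> path_image s" by blast
    then obtain X Y where XY: "path_connected X" "path_connected Y" "x 1 \<in> X" "x 2 \<in> Y"
      "X \<union> Y = path_image s" "X \<inter> Y = {a}"
      using arc_split[OF s(1)] s by metis
    then show ?thesis
      by (intro that[of X Y Z a]) (use Z s(2) in blast)+
  qed
  define T where "T = (\<lambda>i::3. if i = 1 then X else if i = 2 then Y else Z)"
  show thesis
  proof (rule that[of T a])
    fix i j :: 3
    show "path_connected (T i)" "T i \<subseteq> A" "x i \<in> T i"
      using conn sub mem exhaust_3[of i] by (auto simp: T_def)
    show "T i \<inter> T j = {a}" if "i \<noteq> j"
      using exhaust_3[of i] exhaust_3[of j] that meet unfolding T_def
      by (elim disjE) (simp_all add: Int_commute)
  qed
qed

lemma path_connected_spider: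
  fixes A :: "'a::banach set" and x :: "3 \<Rightarrow> 'a"
  assumes A: "path_connected A" and L: "\<And>i. path_connected (L i)"
    and LA: "\<And>i. L i \<inter> A = {x i}" and LL: "\<And>i j. i \<noteq> j \<Longrightarrow> L i \<inter> L j \<subseteq> A"
  obtains a S where "a \<in> A" "\<And>i. path_connected (S i)" "\<And>i. a \<in> S i" "\<And>i. L i \<subseteq> S i"
    "\<And>i. S i \<subseteq> A \<union> L i"
    "\<And>i j. i \<noteq> j \<Longrightarrow> S i \<inter> S j = {a}"
proof -
  have x: "x i \<in> A" "x i \<in> L i" for i using LA[of i] by auto
  obtain a T where T: "\<And>i. path_connected (T i)" "\<And>i. T i \<subseteq> A" "\<And>i. x i \<in> T i"
    and meet: "\<And>i j. i \<noteq> j \<Longrightarrow> T i \<inter> T j = {a}"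
    using path_connected_tripod[of A x] A x(1) by metis
  have a: "a \<in> T i" for i
  proof -
    have "i \<noteq> i + 1" by simp
    then show ?thesis using meet by blast
  qed
  show thesis
  proof (rule that[of a "\<lambda>i. T i \<union> L i"])
    show "a \<in> A" using a T(2) by blast
    fix i j :: 3
    show "path_connected (T i \<union> L i)"
      by (rule path_connected_Un[OF T(1) L]) (use T(3)[of i] x(2)[of i] in blast)
    show "a \<in> T i \<union> L i" "L i \<subseteq> T i \<union> L i" "T i \<union> L i \<subseteq> A \<union> L i"
      using a T(2) by auto
    show "(T i \<union> L i) \<inter> (T j \<union> L j) = {a}" if ij: "i \<noteq> j"
    proof -
      have "L k \<inter> A \<subseteq> T k" for k
        using LA T(3) by simp
      then have "(T i \<union> L i) \<inter> (T j \<union> L j) \<subseteq> T i \<inter> T j"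
        using T(2) LL[OF ij] by blast
      then show ?thesis
        using meet[OF ij] by blast
    qed
  qed
qed

locale K33_continua =
  fixes A B :: "3 \<Rightarrow> 'a::banach set" and L :: "3 \<Rightarrow> 3 \<Rightarrow> 'a set" and x :: "3 \<Rightarrow> 3 \<Rightarrow> 'a"
  assumes A: "path_connected (A i)" "closed (A i)"
    and B: "path_connected (B j)"
    and L: "path_connected (L i j)" "closed (L i j)"
    and AA: "i \<noteq> k \<Longrightarrow> A i \<inter> A k = {}"
    and BB: "j \<noteq> l \<Longrightarrow> B j \<inter> B l = {}"
    and AB: "A i \<inter> B j = {}"
    and LA: "L i j \<inter> A i = {x i j}" "i \<noteq> k \<Longrightarrow> L i j \<inter> A k = {}"
    and LB: "L i j \<inter> B j \<noteq> {}" "j \<noteq> l \<Longrightarrow> L i j \<inter> B l = {}"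
    and LL: "j \<noteq> l \<Longrightarrow> L i j \<inter> L i l \<subseteq> A i" "i \<noteq> k \<Longrightarrow> L i j \<inter> L k j \<subseteq> B j"
      "i \<noteq> k \<Longrightarrow> j \<noteq> l \<Longrightarrow> L i j \<inter> L k l = {}"
begin

abbreviation arm :: "3 \<Rightarrow> 3 \<Rightarrow> 'a set" where
  "arm i j \<equiv> A i \<union> L i j"

lemma arm_Int_B: "j \<noteq> l \<Longrightarrow> arm i j \<inter> B l = {}"
  using AB[of i l] LB(2)[of j l i] by blast

lemma arm_Int_arm: "i \<noteq> k \<Longrightarrow> arm i j \<inter> arm k l \<subseteq> (if j = l then B j else {})"
  using AA[of i k] LA(2)[of i k j] LA(2)[of k i l] LL(2)[of i k j] LL(3)[of i k j l]
  by (cases "j = l") (simp_all, blast+)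

lemma theta_continua:
  obtains a b S where "a \<in> A 1" "b \<in> A 2" "\<And>j. path_connected (S j)" "\<And>j. {a, b} \<subseteq> S j"
    "\<And>j. S j \<subseteq> arm 1 j \<union> B j \<union> arm 2 j" "\<And>j k. j \<noteq> k \<Longrightarrow> S j \<inter> S k = {a, b}"
proof -
  obtain a T where a: "a \<in> A 1"
    and T: "\<And>j. path_connected (T j)" "\<And>j. a \<in> T j" "\<And>j. L 1 j \<subseteq> T j" "\<And>j. T j \<subseteq> arm 1 j"
    and T_meet: "\<And>j k. j \<noteq> k \<Longrightarrow> T j \<inter> T k = {a}"
    using path_connected_spider[of "A 1" "L 1" "x 1"] A(1) L(1) LA(1) LL(1) by metis
  obtain b U where b: "b \<in> A 2"
    and U: "\<And>j. path_connected (U j)" "\<And>j. b \<in> U j" "\<And>j. L 2 j \<subseteq> U j" "\<And>j. U j \<subseteq> arm 2 j"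
    and U_meet: "\<And>j k. j \<noteq> k \<Longrightarrow> U j \<inter> U k = {b}"
    using path_connected_spider[of "A 2" "L 2" "x 2"] A(1) L(1) LA(1) LL(1) by metis
  show thesis
  proof (rule that[OF a b, of "\<lambda>j. T j \<union> B j \<union> U j"])
    fix j k :: 3
    show "path_connected (T j \<union> B j \<union> U j)"
      by (intro path_connected_Un T U B)
        (use T(3)[of j] U(3)[of j] LB(1)[of 1 j] LB(1)[of 2 j] in blast)+
    show "{a, b} \<subseteq> T j \<union> B j \<union> U j" "T j \<union> B j \<union> U j \<subseteq> arm 1 j \<union> B j \<union> arm 2 j"
      using T(2,4) U(2,4) by blast+
    have cross: "T j \<inter> B k = {}" "U j \<inter> B k = {}" "T j \<inter> U k = {}" if "j \<noteq> k" for j k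
    proof -
      show "T j \<inter> B k = {}" "U j \<inter> B k = {}"
        using T(4)[of j] U(4)[of j] arm_Int_B[OF that] by blast+
      have "arm 1 j \<inter> arm 2 k = {}"
        using arm_Int_arm[of 1 2 j k] that by simp
      then show "T j \<inter> U k = {}"
        using T(4)[of j] U(4)[of k] by blast
    qed
    show "(T j \<union> B j \<union> U j) \<inter> (T k \<union> B k \<union> U k) = {a, b}" if jk: "j \<noteq> k"
    proof -
      have "(T j \<union> B j \<union> U j) \<inter> (T k \<union> B k \<union> U k) = (T j \<inter> T k) \<union> (U j \<inter> U k)"
        using cross[OF jk] cross[OF jk[symmetric]] BB[OF jk] by blast
      then show ?thesis
        using T_meet[OF jk] U_meet[OF jk] by auto
    qed
  qed
qed

lemma theta_curve:
  obtains a b c where "a \<in> A 1" "b \<in> A 2"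
    "\<And>j. arc (c j)" "\<And>j. pathstart (c j) = a" "\<And>j. pathfinish (c j) = b"
    "\<And>j. path_image (c j) \<subseteq> arm 1 j \<union> B j \<union> arm 2 j"
    "\<And>j k. j \<noteq> k \<Longrightarrow> path_image (c j) \<inter> path_image (c k) = {a, b}"
proof -
  obtain a b S where ab: "a \<in> A 1" "b \<in> A 2"
    and S: "\<And>j. path_connected (S j)" "\<And>j. {a, b} \<subseteq> S j" "\<And>j. S j \<subseteq> arm 1 j \<union> B j \<union> arm 2 j"
    and meet: "\<And>j k. j \<noteq> k \<Longrightarrow> S j \<inter> S k = {a, b}"
    using theta_continua by metis
  have "a \<noteq> b"
    using ab AA[of 1 2] by auto
  then have "\<exists>c. arc c \<and> path_image c \<subseteq> S j \<and> pathstart c = a \<and> pathfinish c = b" for j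
    using S(1,2) unfolding path_connected_arcwise by blast
  then obtain c where c: "\<And>j. arc (c j)" "\<And>j. path_image (c j) \<subseteq> S j"
    "\<And>j. pathstart (c j) = a" "\<And>j. pathfinish (c j) = b"
    by metis
  have "{a, b} \<subseteq> path_image (c j)" for j
    using c(3,4)[of j] pathstart_in_path_image[of "c j"] pathfinish_in_path_image[of "c j"] by simp
  then have "path_image (c j) \<inter> path_image (c k) = {a, b}" if "j \<noteq> k" for j k
    using c(2)[of j] c(2)[of k] meet[OF that] by blast
  then show thesis
    by (rule that[OF ab c(1,3,4) order_trans[OF c(2) S(3)]])
qed

lemma connected_across_meets_B:
  assumes X: "connected X" "X \<subseteq> arm i j \<union> B j \<union> arm k j" and ik: "i \<noteq> k"
    and ends: "A i \<inter> X \<noteq> {}" "A k \<inter> X \<noteq> {}"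
  shows "X \<inter> B j \<noteq> {}"
proof
  assume "X \<inter> B j = {}"
  then have "X \<subseteq> arm i j \<union> arm k j" "arm i j \<inter> arm k j \<inter> X = {}"
    using X(2) arm_Int_arm[OF ik, of j j] by auto
  moreover have "closed (arm i j)" "closed (arm k j)"
    by (intro closed_Un A L)+
  ultimately have "arm i j \<inter> X = {} \<or> arm k j \<inter> X = {}"
    using connected_closedD[OF X(1)] by blast
  then show False
    using ends by blast
qed

end

theorem no_K33_continua_in_plane:
  fixes A B :: "3 \<Rightarrow> complex set"
  shows "\<not> K33_continua A B L x"
proof
  assume "K33_continua A B L x"
  then interpret K33_continua A B L x .
  obtain a b c where ab: "a \<in> A 1" "b \<in> A 2"
    and c: "\<And>j. arc (c j)" "\<And>j. pathstart (c j) = a" "\<And>j. pathfinish (c j) = b"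
    and cover: "\<And>j. path_image (c j) \<subseteq> arm 1 j \<union> B j \<union> arm 2 j"
    and meet: "\<And>j k. j \<noteq> k \<Longrightarrow> path_image (c j) \<inter> path_image (c k) = {a, b}"
    using theta_curve by blast
  define Q where "Q = (\<lambda>j. arm 3 j \<union> B j)"
  obtain q where q: "q \<in> A 3"
    using LA(1)[of 3] by blast
  have "connected (Q j)" for j
    unfolding Q_def
    by (intro path_connected_imp_connected path_connected_Un A B L)
      (use LA(1)[of 3 j] LB(1)[of 3 j] in blast)+
  moreover have "Q j \<inter> path_image (c j) \<noteq> {}" for j
  proof -
    have "connected (path_image (c j))"
      using c by (simp add: connected_path_image arc_imp_path)
    moreover have "A 1 \<inter> path_image (c j) \<noteq> {}" "A 2 \<inter> path_image (c j) \<noteq> {}"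
      using ab c[of j] pathstart_in_path_image[of "c j"] pathfinish_in_path_image[of "c j"] by auto
    ultimately show ?thesis
      using connected_across_meets_B[of "path_image (c j)" 1 j 2] cover[of j] by (auto simp: Q_def)
  qed
  moreover have "Q j \<inter> path_image (c k) = {}" if jk: "j \<noteq> k" for j k
  proof -
    have "Q j \<inter> arm i k = {}" if "i \<noteq> 3" for i
      using that jk arm_Int_arm[of 3 i j k] arm_Int_B[of k j i] unfolding Q_def by auto
    moreover have "Q j \<inter> B k = {}"
      using jk arm_Int_B[of j k 3] BB[of j k] unfolding Q_def by blast
    ultimately have "Q j \<inter> (arm 1 k \<union> B k \<union> arm 2 k) = {}"
      by (simp add: Int_Un_distrib)
    then show ?thesis
      using cover[of k] by blast
  qed
  moreover have "q \<in> Q j" for j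
    using q by (simp add: Q_def)
  ultimately show False
    using theta_curve_obstruction[of c a b Q q] c meet by blast
qed

section \<open>Minors of graphs given by edge relations\<close>

definition connected_in :: "'a rel \<Rightarrow> 'a set \<Rightarrow> bool" where
  "connected_in E S \<longleftrightarrow> (\<forall>u\<in>S. \<forall>v\<in>S. (u, v) \<in> (Restr E S)\<^sup>*)"

text \<open>Isolated vertices of \<open>H\<close> are ignored: their branch sets may be empty.\<close>

definition minor :: "'b rel \<Rightarrow> 'a rel \<Rightarrow> bool" where
  "minor H E \<longleftrightarrow> (\<exists>B :: 'b \<Rightarrow> 'a set. disjoint_family B \<and> (\<forall>h. connected_in E (B h)) \<and>
     (\<forall>(h, k)\<in>H. E \<inter> B h \<times> B k \<noteq> {}))"

definition K33 :: "(bool \<times> 3) rel" where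
  "K33 = {(u, v). fst u \<noteq> fst v}"

lemma connected_inD: "connected_in E S \<Longrightarrow> u \<in> S \<Longrightarrow> v \<in> S \<Longrightarrow> (u, v) \<in> (Restr E S)\<^sup>*"
  by (simp add: connected_in_def)

lemma connected_in_mono:
  assumes "connected_in E S" "E \<subseteq> F"
  shows "connected_in F S"
proof -
  have "(Restr E S)\<^sup>* \<subseteq> (Restr F S)\<^sup>*"
    by (rule rtrancl_mono) (use assms(2) in blast)
  then show ?thesis
    using assms(1) unfolding connected_in_def by blast
qed

lemma connected_in_singleton: "connected_in E {x}"
  by (simp add: connected_in_def)

lemma connected_in_star:
  assumes "sym E" "X \<subseteq> E `` {x}"
  shows "connected_in E (insert x X)"
proof -
  let ?r = "Restr E (insert x X)"
  have "(x, u) \<in> ?r\<^sup>*" "(u, x) \<in> ?r\<^sup>*" if "u \<in> insert x X" for u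
    using that assms by (cases "u = x"; auto dest: symD)+
  then show ?thesis
    unfolding connected_in_def by (meson rtrancl_trans)
qed

lemma connected_in_vimage:
  assumes S: "connected_in (map_prod f f ` E) S" and fibres: "\<And>c. c \<in> S \<Longrightarrow> connected_in E (f -` {c})"
  shows "connected_in E (f -` S)"
  unfolding connected_in_def
proof (intro ballI)
  let ?r = "Restr E (f -` S)"
  have fibre: "(a, b) \<in> ?r\<^sup>*" if "f a \<in> S" "f a = f b" for a b
  proof -
    have "(Restr E (f -` {f a}))\<^sup>* \<subseteq> ?r\<^sup>*"
      by (rule rtrancl_mono) (use that in auto)
    then show ?thesis
      using connected_inD[OF fibres[OF that(1)], of a b] that by auto
  qed
  fix u v assume u: "u \<in> f -` S" and v: "v \<in> f -` S"
  have "(f u, f v) \<in> (Restr (map_prod f f ` E) S)\<^sup>*"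
    using S u v by (auto dest: connected_inD)
  then show "(u, v) \<in> ?r\<^sup>*"
    using v
  proof (induction "f v" arbitrary: v rule: rtrancl_induct)
    case base
    then show ?case using fibre[of u v] by simp
  next
    case (step y)
    then obtain a b where ab: "(a, b) \<in> E" "f a = y" "f b = f v" "f a \<in> S" "f b \<in> S" by auto
    have "(u, a) \<in> ?r\<^sup>*" by (rule step.hyps(3)) (use ab in auto)
    also have "(a, b) \<in> ?r" using ab by simp
    also have "(b, v) \<in> ?r\<^sup>*" by (rule fibre) (use ab in auto)
    finally show ?case .
  qed
qed

lemma minorI:
  assumes "disjoint_family B" "\<And>h. connected_in E (B h)" "\<And>h k. (h, k) \<in> H \<Longrightarrow> E \<inter> B h \<times> B k \<noteq> {}"
  shows "minor H E"
  using assms unfolding minor_def by blast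

lemma minorE:
  assumes "minor H E"
  obtains B where "disjoint_family B" "\<And>h. connected_in E (B h)"
    "\<And>h k. (h, k) \<in> H \<Longrightarrow> E \<inter> B h \<times> B k \<noteq> {}"
  using assms unfolding minor_def by fast

lemma minor_mono:
  assumes "minor H E" "E \<subseteq> F"
  shows "minor H F"
proof -
  obtain B where B: "disjoint_family B" "\<And>h. connected_in E (B h)"
    "\<And>h k. (h, k) \<in> H \<Longrightarrow> E \<inter> B h \<times> B k \<noteq> {}"
    using minorE[OF assms(1)] by blast
  show ?thesis
    by (rule minorI[OF B(1) connected_in_mono[OF B(2) assms(2)]]) (use B(3) assms(2) in blast)
qed

lemma minor_contraction:
  assumes minor: "minor H F" and F: "F \<subseteq> map_prod f f ` E"
    and fibres: "\<And>c. connected_in E (f -` {c})"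
  shows "minor H E"
proof -
  obtain B where B: "disjoint_family B" "\<And>h. connected_in F (B h)"
    "\<And>h k. (h, k) \<in> H \<Longrightarrow> F \<inter> B h \<times> B k \<noteq> {}"
    using minorE[OF minor] by blast
  have "disjoint_family (\<lambda>h. f -` B h)"
    using B(1) unfolding disjoint_family_on_def by blast
  moreover have "connected_in E (f -` B h)" for h
    using connected_in_vimage[OF connected_in_mono[OF B(2) F]] fibres by blast
  moreover have "E \<inter> (f -` B h) \<times> (f -` B k) \<noteq> {}" if hk: "(h, k) \<in> H" for h k
  proof -
    obtain x y where "(x, y) \<in> F" "x \<in> B h" "y \<in> B k" using B(3)[OF hk] by blast
    then show ?thesis using F by auto
  qed
  ultimately show ?thesis
    by (rule minorI)
qed

lemma K33_minor_of_hubs: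
  assumes "sym E" and T: "3 \<le> card T" "T \<subseteq> E `` X \<inter> E `` Y \<inter> E `` Z" "T \<inter> (X \<union> Y \<union> Z) = {}"
    and conn: "connected_in E X" "connected_in E Y" "connected_in E Z"
    and disj: "X \<inter> Y = {}" "X \<inter> Z = {}" "Y \<inter> Z = {}"
  shows "minor K33 E"
proof -
  obtain T' where T': "T' \<subseteq> T" "card T' = 3"
    using obtain_subset_with_card_n[OF T(1)] by metis
  then have "finite T'" by (metis card.infinite zero_neq_numeral)
  moreover have "card (UNIV :: 3 set) = card T'" using T' by simp
  ultimately obtain t :: "3 \<Rightarrow> 'a" where t: "bij_betw t UNIV T'"
    by (metis finite finite_same_card_bij)
  define hub where "hub = (\<lambda>i::3. if i = 1 then X else if i = 2 then Y else Z)"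
  have hub: "connected_in E (hub i)" "T \<subseteq> E `` hub i" "T \<inter> hub i = {}" for i
    using conn T(2,3) by (auto simp: hub_def)
  have hubs: "hub i \<inter> hub j = {}" if "i \<noteq> j" for i j
    using that disj exhaust_3[of i] exhaust_3[of j] by (auto simp: hub_def)
  have t_in_T: "t i \<in> T" for i
    using t T'(1) bij_betwE by blast
  have t_inj: "t i \<noteq> t j" if "i \<noteq> j" for i j
    using t that by (auto simp: bij_betw_def inj_def)
  define B where "B = (\<lambda>(side, i). if side then hub i else {t i})"
  have "disjoint_family B"
    unfolding disjoint_family_on_def B_def using hub(3) t_in_T hubs t_inj by auto
  moreover have "connected_in E (B h)" for h
    using hub(1) connected_in_singleton by (auto simp: B_def split: prod.split)
  moreover have "E \<inter> B h \<times> B k \<noteq> {}" if "(h, k) \<in> K33" for h k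
  proof -
    have "\<exists>u\<in>hub i. (u, t j) \<in> E \<and> (t j, u) \<in> E" for i j
      using hub(2)[of i] t_in_T[of j] \<open>sym E\<close> by (blast dest: symD)
    then show ?thesis
      using that by (fastforce simp: K33_def B_def split: prod.splits if_splits)
  qed
  ultimately show ?thesis
    by (rule minorI)
qed

definition same_branch :: "('b \<Rightarrow> 'a set) \<Rightarrow> 'a \<Rightarrow> 'a \<Rightarrow> bool" where
  "same_branch B u v \<longleftrightarrow> (\<exists>h. u \<in> B h \<and> v \<in> B h)"

definition touching :: "'b rel \<Rightarrow> ('b \<Rightarrow> 'a set) \<Rightarrow> 'a \<Rightarrow> 'a \<Rightarrow> bool" where
  "touching H B u v \<longleftrightarrow> (\<exists>h k. u \<in> B h \<and> v \<in> B k \<and> (h, k) \<in> H\<^sup>=)"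

text \<open>A leaf of a Y whose branch set can absorb the centre: it serves every two leaves in equal or
  adjacent branch sets.\<close>

definition absorbing_leaf :: "'b rel \<Rightarrow> ('b \<Rightarrow> 'a set) \<Rightarrow> 'a set \<Rightarrow> 'a \<Rightarrow> bool" where
  "absorbing_leaf H B D w \<longleftrightarrow> w \<in> D \<and>
     (\<forall>u\<in>D. \<forall>v\<in>D. u \<noteq> v \<and> touching H B u v \<longrightarrow> same_branch B w u \<or> same_branch B w v)"

lemma disjoint_familyD: "disjoint_family B \<Longrightarrow> u \<in> B h \<Longrightarrow> u \<in> B k \<Longrightarrow> h = k"
  unfolding disjoint_family_on_def by blast

lemma same_branch_sym: "same_branch B u v \<Longrightarrow> same_branch B v u"
  unfolding same_branch_def by blast

lemma touching_sym: "sym H \<Longrightarrow> touching H B u v \<Longrightarrow> touching H B v u"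
  unfolding touching_def by (blast dest: symD)

lemma touching_imp_same_branch: "touching H B u v \<Longrightarrow> same_branch B u u \<and> same_branch B v v"
  unfolding touching_def same_branch_def by blast

lemma triangle_free_touching:
  assumes B: "disjoint_family B" and H: "H O H \<inter> H = {}"
    and touch: "touching H B a b" "touching H B a c" "touching H B b c"
  shows "same_branch B a b \<or> same_branch B a c \<or> same_branch B b c"
proof (rule ccontr)
  assume distinct: "\<not> ?thesis"
  obtain h k where hk: "a \<in> B h" "b \<in> B k" "(h, k) \<in> H"
    using touch(1) distinct unfolding touching_def same_branch_def by blast
  obtain h' l where hl: "a \<in> B h'" "c \<in> B l" "(h', l) \<in> H"
    using touch(2) distinct unfolding touching_def same_branch_def by blast
  obtain k' l' where kl: "b \<in> B k'" "c \<in> B l'" "(k', l') \<in> H"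
    using touch(3) distinct unfolding touching_def same_branch_def by blast
  have "h' = h" "k' = k" "l' = l"
    using disjoint_familyD[OF B] hk hl kl by metis+
  then show False
    using H hk(3) hl(3) kl(3) by blast
qed

lemma absorbing_leaf_exists:
  assumes B: "disjoint_family B" and H: "sym H" "H O H \<inter> H = {}"
    and D: "finite D" "card D \<le> 3" "D \<noteq> {}"
  shows "\<exists>w. absorbing_leaf H B D w"
proof -
  let ?touch = "touching H B" and ?same = "same_branch B"
  obtain a b c where abc: "D = {a, b, c}"
  proof -
    consider "card D = 1" | "card D = 2" | "card D = 3"
      using D by (metis card_0_eq le_SucE le_zero_eq numeral_2_eq_2 numeral_3_eq_3 One_nat_def)
    then show ?thesis
      using that by cases (auto simp: card_1_singleton_iff card_2_iff card_3_iff)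
  qed
  consider "?same a b \<or> ?same a c \<or> \<not> ?touch b c" | "?same b a \<or> ?same b c \<or> \<not> ?touch a c"
    | "?same c a \<or> ?same c b \<or> \<not> ?touch a b"
    using triangle_free_touching[OF B H(2), of a b c] same_branch_sym[of B] by metis
  then show ?thesis
    unfolding absorbing_leaf_def abc
    using touching_sym[OF H(1), of B] touching_imp_same_branch[of H B] by cases blast+
qed

definition Y_Delta :: "'a rel \<Rightarrow> 'a set \<Rightarrow> 'a set \<Rightarrow> ('a \<Rightarrow> 'a set) \<Rightarrow> 'a rel" where
  "Y_Delta E R S \<tau> = Restr (E \<union> (\<Union>s\<in>S. \<tau> s \<times> \<tau> s)) R"

context
  fixes E :: "'a rel" and R S :: "'a set" and \<tau> :: "'a \<Rightarrow> 'a set" and H :: "'b rel"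
    and B :: "'b \<Rightarrow> 'a set" and w :: "'a \<Rightarrow> 'a"
  assumes E: "sym E" and leaves: "\<And>s. s \<in> S \<Longrightarrow> \<tau> s \<subseteq> R \<inter> E `` {s}" and SR: "S \<inter> R = {}"
    and B: "disjoint_family B" and w: "\<And>s. s \<in> S \<Longrightarrow> absorbing_leaf H B (\<tau> s) (w s)"
begin

definition absorbed :: "'b \<Rightarrow> 'a set" where
  "absorbed h = B h \<inter> R \<union> {s \<in> S. w s \<in> B h}"

lemma disjoint_family_absorbed: "disjoint_family absorbed"
  using disjoint_familyD[OF B] SR unfolding disjoint_family_on_def absorbed_def by blast

lemma leaf_edge:
  assumes "s \<in> S" "u \<in> \<tau> s"
  shows "(s, u) \<in> E" "(u, s) \<in> E" "u \<in> R"
  using leaves[OF assms(1)] assms(2) E by (auto dest: symD)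

lemma Y_Delta_edge_cases:
  assumes "(a, b) \<in> Y_Delta E R S \<tau>" "a \<in> B h" "b \<in> B k" "(h, k) \<in> H\<^sup>=" "a \<noteq> b"
  obtains "(a, b) \<in> E" | s where "(a, s) \<in> E" "(s, b) \<in> E" "s \<in> absorbed h \<union> absorbed k"
proof -
  consider "(a, b) \<in> E" | s where "s \<in> S" "a \<in> \<tau> s" "b \<in> \<tau> s"
    using assms(1) unfolding Y_Delta_def by blast
  then show thesis
  proof cases
    case (2 s)
    have "touching H B a b"
      using assms unfolding touching_def by blast
    then have "same_branch B (w s) a \<or> same_branch B (w s) b"
      using w[OF 2(1)] 2 assms(5) unfolding absorbing_leaf_def by blast
    then have "w s \<in> B h \<or> w s \<in> B k"
      using disjoint_familyD[OF B] assms(2,3) unfolding same_branch_def by blast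
    then show ?thesis
      using that(2)[of s] leaf_edge[OF 2(1)] 2 by (auto simp: absorbed_def)
  qed (rule that(1))
qed

lemma connected_in_absorbed:
  assumes "connected_in (Y_Delta E R S \<tau>) (B h)"
  shows "connected_in E (absorbed h)"
proof -
  let ?r = "Restr E (absorbed h)"
  have "Restr (Y_Delta E R S \<tau>) (B h) \<subseteq> ?r\<^sup>*"
  proof clarify
    fix a b assume ab: "(a, b) \<in> Y_Delta E R S \<tau>" "a \<in> B h" "b \<in> B h"
    then have absorbed: "a \<in> absorbed h" "b \<in> absorbed h" by (auto simp: Y_Delta_def absorbed_def)
    show "(a, b) \<in> ?r\<^sup>*"
    proof (cases "a = b")
      case False
      have "(h, h) \<in> H\<^sup>=" by simp
      from ab this False consider "(a, b) \<in> E" | s where "(a, s) \<in> E" "(s, b) \<in> E" "s \<in> absorbed h"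
        by (rule Y_Delta_edge_cases) auto
      then show ?thesis
      proof cases
        case (2 s)
        then have "(a, s) \<in> ?r" "(s, b) \<in> ?r" using absorbed by auto
        then show ?thesis by (meson r_into_rtrancl rtrancl_trans)
      qed (use absorbed in auto)
    qed simp
  qed
  then have inner: "(a, b) \<in> ?r\<^sup>*" if "a \<in> B h" "b \<in> B h" for a b
    using that connected_inD[OF assms] rtrancl_subset_rtrancl by blast
  have "\<exists>a\<in>B h. (u, a) \<in> ?r\<^sup>* \<and> (a, u) \<in> ?r\<^sup>*" if u: "u \<in> absorbed h" for u
  proof (cases "u \<in> B h")
    case False
    then have "u \<in> S" "w u \<in> B h" using u by (auto simp: absorbed_def)
    moreover from this have "w u \<in> \<tau> u" using w by (simp add: absorbing_leaf_def)
    ultimately have "(u, w u) \<in> ?r" "(w u, u) \<in> ?r"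
      using u leaf_edge[of u "w u"] by (auto simp: absorbed_def)
    then show ?thesis using \<open>w u \<in> B h\<close> by blast
  qed blast
  then show ?thesis
    unfolding connected_in_def using inner by (meson rtrancl_trans)
qed

lemma absorbed_joined:
  assumes edge: "Y_Delta E R S \<tau> \<inter> B h \<times> B k \<noteq> {}" and hk: "(h, k) \<in> H" "h \<noteq> k"
  shows "E \<inter> absorbed h \<times> absorbed k \<noteq> {}"
proof -
  obtain a b where ab: "(a, b) \<in> Y_Delta E R S \<tau>" "a \<in> B h" "b \<in> B k" using edge by blast
  then have absorbed: "a \<in> absorbed h" "b \<in> absorbed k" by (auto simp: Y_Delta_def absorbed_def)
  have "(h, k) \<in> H\<^sup>=" "a \<noteq> b" using hk ab disjoint_familyD[OF B] by auto
  with ab show ?thesis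
    by (rule Y_Delta_edge_cases) (use absorbed in blast)+
qed

end

theorem minor_Y_Delta:
  assumes E: "sym E" and H: "sym H" "H O H \<inter> H = {}"
    and leaves: "\<And>s. s \<in> S \<Longrightarrow> finite (\<tau> s)" "\<And>s. s \<in> S \<Longrightarrow> card (\<tau> s) \<le> 3"
      "\<And>s. s \<in> S \<Longrightarrow> \<tau> s \<subseteq> R \<inter> E `` {s}"
    and SR: "S \<inter> R = {}" and minor: "minor H (Y_Delta E R S \<tau>)"
  shows "minor H E"
proof -
  define S' where "S' = {s \<in> S. \<tau> s \<noteq> {}}"
  have "Y_Delta E R S \<tau> = Y_Delta E R S' \<tau>"
    unfolding Y_Delta_def S'_def by blast
  then obtain B where B: "disjoint_family B" "\<And>h. connected_in (Y_Delta E R S' \<tau>) (B h)"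
    and edges: "\<And>h k. (h, k) \<in> H \<Longrightarrow> Y_Delta E R S' \<tau> \<inter> B h \<times> B k \<noteq> {}"
    using minorE[OF minor] by metis
  have "\<exists>w. absorbing_leaf H B (\<tau> s) w" if "s \<in> S'" for s
    using that by (intro absorbing_leaf_exists[OF B(1) H] leaves) (auto simp: S'_def)
  then obtain w where w: "\<And>s. s \<in> S' \<Longrightarrow> absorbing_leaf H B (\<tau> s) (w s)"
    by metis
  have S': "\<And>s. s \<in> S' \<Longrightarrow> \<tau> s \<subseteq> R \<inter> E `` {s}" "S' \<inter> R = {}"
    using leaves(3) SR by (auto simp: S'_def)
  show ?thesis
  proof (rule minorI)
    show "disjoint_family (absorbed R S' B w)"
      by (rule disjoint_family_absorbed[OF E S' B(1) w])
    fix h k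
    show "connected_in E (absorbed R S' B w h)"
      by (rule connected_in_absorbed[OF E S' B(1) w B(2)])
    assume hk: "(h, k) \<in> H"
    then have "h \<noteq> k" using H(2) by blast
    with hk show "E \<inter> absorbed R S' B w h \<times> absorbed R S' B w k \<noteq> {}"
      using absorbed_joined[OF E S' B(1) w edges[OF hk]] by simp
  qed
qed

section \<open>Planar graphs have no \<open>K\<^sub>3\<^sub>,\<^sub>3\<close> minor\<close>

locale graph_drawing =
  fixes V :: "nat set" and E :: "nat set set" and P :: "nat \<Rightarrow> 'a::euclidean_space"
    and \<gamma> :: "nat set \<Rightarrow> real \<Rightarrow> 'a"
  assumes simple: "simple_graph V E"
    and inj: "inj_on P V"
    and arc: "e \<in> E \<Longrightarrow> arc (\<gamma> e)"
    and ends: "e \<in> E \<Longrightarrow> {pathstart (\<gamma> e), pathfinish (\<gamma> e)} = P ` e"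
    and vertex_avoiding: "e \<in> E \<Longrightarrow> path_image (\<gamma> e) \<inter> P ` V \<subseteq> P ` e"
    and noncrossing: "e \<in> E \<Longrightarrow> e' \<in> E \<Longrightarrow> e \<noteq> e' \<Longrightarrow> path_image (\<gamma> e) \<inter> path_image (\<gamma> e') \<subseteq> P ` (e \<inter> e')"

lemma planar_iff_graph_drawing: "planar V E \<longleftrightarrow> (\<exists>(P :: nat \<Rightarrow> real^2) \<gamma>. graph_drawing V E P \<gamma>)"
proof
  assume "planar V E"
  then obtain P :: "nat \<Rightarrow> real^2" and \<gamma> where "simple_graph V E" "inj_on P V"
    "\<forall>e\<in>E. arc (\<gamma> e) \<and> {pathstart (\<gamma> e), pathfinish (\<gamma> e)} = P ` e
      \<and> path_image (\<gamma> e) \<inter> P ` V \<subseteq> P ` e"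
    "\<forall>e\<in>E. \<forall>e'\<in>E. e \<noteq> e' \<longrightarrow> path_image (\<gamma> e) \<inter> path_image (\<gamma> e') \<subseteq> P ` (e \<inter> e')"
    unfolding planar_def by (elim conjE exE)
  then have "graph_drawing V E P \<gamma>" by unfold_locales blast+
  then show "\<exists>(P :: nat \<Rightarrow> real^2) \<gamma>. graph_drawing V E P \<gamma>" by blast
next
  assume "\<exists>(P :: nat \<Rightarrow> real^2) \<gamma>. graph_drawing V E P \<gamma>"
  then obtain P :: "nat \<Rightarrow> real^2" and \<gamma> where "graph_drawing V E P \<gamma>" by blast
  then show "planar V E"
    unfolding planar_def graph_drawing_def by (intro conjI exI[of _ P] exI[of _ \<gamma>]) simp_all
qed

context graph_drawing
begin

lemma graph_drawing_linear_image:
  fixes h :: "'a \<Rightarrow> 'b::euclidean_space"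
  assumes h: "linear h" "inj h"
  shows "graph_drawing V E (h \<circ> P) (\<lambda>e. h \<circ> \<gamma> e)"
proof -
  have h_Int: "h ` X \<inter> h ` Y \<subseteq> h ` Z" if "X \<inter> Y \<subseteq> Z" for X Y Z
    using that h(2) by (auto simp: inj_def)
  show ?thesis
  proof
    show "simple_graph V E" by (rule simple)
    show "inj_on (h \<circ> P) V"
      using inj h(2) by (intro comp_inj_on) (auto intro: inj_on_subset)
    fix e assume e: "e \<in> E"
    show "arc (h \<circ> \<gamma> e)"
      using arc[OF e] h by (simp add: arc_linear_image_eq)
    have "{pathstart (h \<circ> \<gamma> e), pathfinish (h \<circ> \<gamma> e)} = h ` {pathstart (\<gamma> e), pathfinish (\<gamma> e)}"
      by (simp add: pathstart_compose pathfinish_compose)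
    then show "{pathstart (h \<circ> \<gamma> e), pathfinish (h \<circ> \<gamma> e)} = (h \<circ> P) ` e"
      unfolding ends[OF e] by (simp add: image_comp)
    show "path_image (h \<circ> \<gamma> e) \<inter> (h \<circ> P) ` V \<subseteq> (h \<circ> P) ` e"
      unfolding image_comp[symmetric] path_image_compose by (rule h_Int[OF vertex_avoiding[OF e]])
    show "path_image (h \<circ> \<gamma> e) \<inter> path_image (h \<circ> \<gamma> e') \<subseteq> (h \<circ> P) ` (e \<inter> e')"
      if "e' \<in> E" "e \<noteq> e'" for e'
      unfolding image_comp[symmetric] path_image_compose by (rule h_Int[OF noncrossing[OF e that]])
  qed
qed

lemma edge_subset: "e \<in> E \<Longrightarrow> e \<subseteq> V"
  using simple by (auto simp: simple_graph_def)

lemma edge_nonempty: "e \<in> E \<Longrightarrow> e \<noteq> {}"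
  using simple by (auto simp: simple_graph_def)

lemma finite_edges: "finite E"
  using simple edge_subset by (auto simp: simple_graph_def intro: finite_subset[of E "Pow V"])

lemma vertex_on_edge: "e \<in> E \<Longrightarrow> w \<in> e \<Longrightarrow> P w \<in> path_image (\<gamma> e)"
  using ends[of e] pathstart_in_path_image[of "\<gamma> e"] pathfinish_in_path_image[of "\<gamma> e"]
  by (metis imageI insertE singletonD)

lemma vertex_on_edge_iff: "e \<in> E \<Longrightarrow> w \<in> V \<Longrightarrow> P w \<in> path_image (\<gamma> e) \<longleftrightarrow> w \<in> e"
  using vertex_avoiding[of e] vertex_on_edge
    inj_on_image_mem_iff[OF inj _ edge_subset[of e]]
  by blast

definition region :: "nat set \<Rightarrow> 'a set" where
  "region S = P ` (S \<inter> V) \<union> (\<Union>e\<in>{e \<in> E. e \<subseteq> S}. path_image (\<gamma> e))"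

lemma region_cases:
  assumes "y \<in> region S"
  obtains (vertex) w where "w \<in> S" "w \<in> V" "y = P w"
    | (edge) e where "e \<in> E" "e \<subseteq> S" "y \<in> path_image (\<gamma> e)"
  using assms unfolding region_def by blast

lemma vertex_in_region: "w \<in> S \<Longrightarrow> w \<in> V \<Longrightarrow> P w \<in> region S"
  by (simp add: region_def)

lemma closed_region: "closed (region S)"
  unfolding region_def using simple finite_edges
  by (intro closed_Un closed_UN)
    (auto simp: simple_graph_def arc intro: finite_imp_closed closed_arc_image)

lemma edge_Int_region:
  assumes e: "e \<in> E" "\<not> e \<subseteq> S"
  shows "path_image (\<gamma> e) \<inter> region S = P ` (e \<inter> S)"
proof
  show "path_image (\<gamma> e) \<inter> region S \<subseteq> P ` (e \<inter> S)"
  proof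
    fix y assume y: "y \<in> path_image (\<gamma> e) \<inter> region S"
    then have "y \<in> region S" by simp
    then show "y \<in> P ` (e \<inter> S)"
    proof (cases rule: region_cases)
      case (vertex w)
      then show ?thesis using y vertex_on_edge_iff[OF e(1)] by auto
    next
      case (edge e')
      then have "y \<in> P ` (e \<inter> e')" using noncrossing[OF e(1), of e'] e(2) y by auto
      then show ?thesis using edge(2) by blast
    qed
  qed
  show "P ` (e \<inter> S) \<subseteq> path_image (\<gamma> e) \<inter> region S"
    using edge_subset[OF e(1)] vertex_on_edge[OF e(1)] vertex_in_region by auto
qed

lemma region_disjoint:
  assumes "S \<inter> T = {}"
  shows "region S \<inter> region T = {}"
proof -
  have "y \<notin> region T" if "y \<in> region S" for y
    using that
  proof (cases rule: region_cases)
    case (vertex w)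
    show ?thesis
    proof
      assume "y \<in> region T"
      then show False
      proof (cases rule: region_cases)
        case (vertex w')
        then show False using \<open>w \<in> S\<close> \<open>w \<in> V\<close> \<open>y = P w\<close> inj assms by (auto dest: inj_onD)
      next
        case (edge e)
        then show False using vertex_on_edge_iff[of e w] vertex assms by blast
      qed
    qed
  next
    case (edge e)
    then have "\<not> e \<subseteq> T" using assms edge_nonempty[of e] by blast
    then have "path_image (\<gamma> e) \<inter> region T = P ` (e \<inter> T)" using edge by (intro edge_Int_region)
    also have "e \<inter> T = {}" using edge assms by blast
    finally show ?thesis using edge by blast
  qed
  then show ?thesis by blast
qed

lemma path_component_region_edge:
  assumes "e \<in> E" "e \<subseteq> S" "x \<in> path_image (\<gamma> e)" "y \<in> path_image (\<gamma> e)"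
  shows "path_component (region S) x y"
proof -
  have "path_connected (path_image (\<gamma> e))"
    using arc[OF assms(1)] by (simp add: arc_imp_path path_connected_path_image)
  then have "path_component (path_image (\<gamma> e)) x y"
    using assms by (simp add: path_connected_component)
  moreover have "path_image (\<gamma> e) \<subseteq> region S"
    using assms by (auto simp: region_def)
  ultimately show ?thesis
    by (metis path_component_of_subset)
qed

lemma path_connected_region:
  assumes S: "connected_in {(u, v). {u, v} \<in> E} S"
  shows "path_connected (region S)"
proof -
  have vertices: "path_component (region S) (P u) (P v)"
    if u: "u \<in> S" "u \<in> V" and v: "v \<in> S" for u v
    using connected_inD[OF S u(1) v]
  proof (induction rule: rtrancl_induct)
    case base
    show ?case using u by (simp add: vertex_in_region path_component_refl)
  next
    case (step v w)
    then have "path_component (region S) (P v) (P w)"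
      by (intro path_component_region_edge[of "{v, w}"]) (auto intro: vertex_on_edge)
    then show ?case using step.IH path_component_trans by blast
  qed
  have "\<exists>w\<in>S \<inter> V. path_component (region S) x (P w)" if x: "x \<in> region S" for x
    using x
  proof (cases rule: region_cases)
    case (vertex w)
    then show ?thesis using x by (auto intro: path_component_refl)
  next
    case (edge e)
    then obtain w where w: "w \<in> e" using edge_nonempty by blast
    then have "path_component (region S) x (P w)"
      using edge by (intro path_component_region_edge[of e]) (auto intro: vertex_on_edge)
    then show ?thesis using w edge edge_subset by blast
  qed
  then show ?thesis
    unfolding path_connected_component
    using vertices by (metis IntD1 IntD2 path_component_sym path_component_trans)
qed

context
  fixes S :: "bool \<times> 3 \<Rightarrow> nat set" and u v :: "3 \<Rightarrow> 3 \<Rightarrow> nat"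
  assumes S: "disjoint_family S" "connected_in {(u, v). {u, v} \<in> E} (S h)"
    and uv: "{u i j, v i j} \<in> E" "u i j \<in> S (True, i)" "v i j \<in> S (False, j)"
begin

abbreviation link :: "3 \<Rightarrow> 3 \<Rightarrow> 'a set" where
  "link i j \<equiv> path_image (\<gamma> {u i j, v i j})"

lemma branch_sets_disjoint: "h \<noteq> k \<Longrightarrow> S h \<inter> S k = {}"
  using S(1) unfolding disjoint_family_on_def by blast

lemma link_ends_in_branch_set: "u i j \<in> S h \<longleftrightarrow> h = (True, i)" "v i j \<in> S h \<longleftrightarrow> h = (False, j)"
  using uv(2,3) branch_sets_disjoint by blast+

lemma link_Int_region:
  "link i j \<inter> region (S (True, k)) = (if i = k then {P (u i j)} else {})"
  "link i j \<inter> region (S (False, l)) = (if j = l then {P (v i j)} else {})"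
  by (simp_all add: edge_Int_region uv(1) link_ends_in_branch_set)

lemma link_Int_link:
  assumes ne: "(i, j) \<noteq> (k, l)"
  shows "link i j \<inter> link k l
    \<subseteq> P ` ((if i = k then {u i j} else {}) \<union> (if j = l then {v i j} else {}))"
proof -
  have distinct: "u i j \<noteq> v k l" "v i j \<noteq> u k l" "u i j = u k l \<Longrightarrow> i = k" "v i j = v k l \<Longrightarrow> j = l"
    using link_ends_in_branch_set by (metis prod.inject)+
  then have "{u i j, v i j} \<noteq> {u k l, v k l}"
    using ne by (auto simp: doubleton_eq_iff)
  then have "link i j \<inter> link k l \<subseteq> P ` ({u i j, v i j} \<inter> {u k l, v k l})"
    by (rule noncrossing[OF uv(1) uv(1)])
  moreover have "{u i j, v i j} \<inter> {u k l, v k l}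
    \<subseteq> (if i = k then {u i j} else {}) \<union> (if j = l then {v i j} else {})"
    using distinct by auto
  ultimately show ?thesis
    by blast
qed

lemma K33_continua_of_model:
  "K33_continua (\<lambda>i. region (S (True, i))) (\<lambda>j. region (S (False, j))) link (\<lambda>i j. P (u i j))"
proof
  fix i j k l :: 3
  show "path_connected (region (S (True, i)))" "path_connected (region (S (False, j)))"
    "closed (region (S (True, i)))"
    by (simp_all add: path_connected_region closed_region S(2))
  show "path_connected (link i j)" "closed (link i j)"
    using arc[OF uv(1)] by (simp_all add: arc_imp_path path_connected_path_image closed_arc_image)
  show "i \<noteq> k \<Longrightarrow> region (S (True, i)) \<inter> region (S (True, k)) = {}"
    "j \<noteq> l \<Longrightarrow> region (S (False, j)) \<inter> region (S (False, l)) = {}"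
    "region (S (True, i)) \<inter> region (S (False, j)) = {}"
    by (simp_all add: region_disjoint branch_sets_disjoint)
  show "link i j \<inter> region (S (True, i)) = {P (u i j)}" "link i j \<inter> region (S (False, j)) \<noteq> {}"
    "i \<noteq> k \<Longrightarrow> link i j \<inter> region (S (True, k)) = {}" "j \<noteq> l \<Longrightarrow> link i j \<inter> region (S (False, l)) = {}"
    by (simp_all add: link_Int_region)
  have "P (u i j) \<in> region (S (True, i))" "P (v i j) \<in> region (S (False, j))"
    using link_Int_region(1)[of i j i] link_Int_region(2)[of i j j] by auto
  then show "j \<noteq> l \<Longrightarrow> link i j \<inter> link i l \<subseteq> region (S (True, i))"
    "i \<noteq> k \<Longrightarrow> link i j \<inter> link k j \<subseteq> region (S (False, j))"
    "i \<noteq> k \<Longrightarrow> j \<noteq> l \<Longrightarrow> link i j \<inter> link k l = {}"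
    using link_Int_link[of i j i l] link_Int_link[of i j k j] link_Int_link[of i j k l] by auto
qed

end

end

lemma planar_complex_drawing:
  assumes "planar V E"
  obtains P :: "nat \<Rightarrow> complex" and \<gamma> where "graph_drawing V E P \<gamma>"
proof -
  obtain P :: "nat \<Rightarrow> real^2" and \<gamma> where "graph_drawing V E P \<gamma>"
    using assms unfolding planar_iff_graph_drawing by blast
  moreover define h :: "real^2 \<Rightarrow> complex" where "h = (\<lambda>x. Complex (x $ 1) (x $ 2))"
  have "linear h"
    by (rule linearI) (auto simp: h_def complex_eq_iff)
  moreover have "inj h"
    by (rule injI) (auto simp: h_def vec_eq_iff forall_2)
  ultimately show thesis
    using that graph_drawing.graph_drawing_linear_image by blast
qed

theorem planar_no_K33_minor:
  assumes "planar V E"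
  shows "\<not> minor K33 {(u, v). {u, v} \<in> E}"
proof
  assume "minor K33 {(u, v). {u, v} \<in> E}"
  then obtain S where S: "disjoint_family S" "\<And>h. connected_in {(u, v). {u, v} \<in> E} (S h)"
    and edges: "\<And>h k. (h, k) \<in> K33 \<Longrightarrow> {(u, v). {u, v} \<in> E} \<inter> S h \<times> S k \<noteq> {}"
    using minorE by blast
  have "\<exists>u v. {u, v} \<in> E \<and> u \<in> S (True, i) \<and> v \<in> S (False, j)" for i j
    using edges[of "(True, i)" "(False, j)"] by (auto simp: K33_def)
  then obtain u v where "\<And>i j. {u i j, v i j} \<in> E" "\<And>i j. u i j \<in> S (True, i)"
    "\<And>i j. v i j \<in> S (False, j)"
    by metis
  moreover obtain P :: "nat \<Rightarrow> complex" and \<gamma> where "graph_drawing V E P \<gamma>"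
    using planar_complex_drawing[OF assms] .
  ultimately show False
    using graph_drawing.K33_continua_of_model[of V E P \<gamma> S u v] S no_K33_continua_in_plane by blast
qed

section \<open>Edges of graphs without \<open>K\<^sub>3\<^sub>,\<^sub>3\<close> minor\<close>

locale K33_minor_free =
  fixes E :: "'a rel"
  assumes sym: "sym E" and irrefl: "irrefl E" and no_K33_minor: "\<not> minor K33 E"
begin

lemma edge_sym: "(u, v) \<in> E \<Longrightarrow> (v, u) \<in> E"
  using sym by (rule symD)

lemma edge_irrefl: "(u, v) \<in> E \<Longrightarrow> u \<noteq> v"
  using irrefl by (auto simp: irrefl_def)

lemma K33_minor_free_subgraph: "F \<subseteq> E \<Longrightarrow> sym F \<Longrightarrow> K33_minor_free F"
  using irrefl no_K33_minor minor_mono[of K33 F E] by unfold_locales (auto simp: irrefl_def)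

end

definition contract :: "'a \<Rightarrow> 'a \<Rightarrow> 'a rel \<Rightarrow> 'a rel" where
  "contract x y E = map_prod (id(y := x)) (id(y := x)) ` E - Id"

lemma (in K33_minor_free) K33_minor_free_contract:
  assumes xy: "(x, y) \<in> E"
  shows "K33_minor_free (contract x y E)"
proof
  show "sym (contract x y E)"
    using sym by (force simp: contract_def sym_def)
  show "irrefl (contract x y E)"
    by (simp add: contract_def irrefl_def)
  have "connected_in E (id(y := x) -` {c})" for c
  proof -
    consider "c = x" | "c = y" "c \<noteq> x" | "c \<noteq> x" "c \<noteq> y" by blast
    then show ?thesis
    proof cases
      case 1
      then have "id(y := x) -` {c} = insert x {y}" by (auto split: if_splits)
      then show ?thesis using connected_in_star[OF sym, of "{y}" x] xy by simp
    next
      case 2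
      then have "id(y := x) -` {c} = {}" by (auto split: if_splits)
      then show ?thesis by (simp add: connected_in_def)
    next
      case 3
      then have "id(y := x) -` {c} = {c}" by (auto split: if_splits)
      then show ?thesis by (simp add: connected_in_singleton)
    qed
  qed
  then show "\<not> minor K33 (contract x y E)"
    using no_K33_minor minor_contraction[of K33 "contract x y E" "id(y := x)" E]
    by (auto simp: contract_def)
qed

lemma contract_subset:
  assumes "E \<subseteq> W \<times> W" "(x, y) \<in> E" "x \<noteq> y"
  shows "contract x y E \<subseteq> (W - {y}) \<times> (W - {y})"
  using assms by (auto simp: contract_def split: if_splits)

lemma card_contract_le:
  assumes "finite E"
  shows "card (contract x y E) \<le> card E"
proof -
  have "card (contract x y E) \<le> card (map_prod (id(y := x)) (id(y := x)) ` E)"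
    unfolding contract_def by (intro card_mono) (use assms in auto)
  also have "\<dots> \<le> card E"
    using assms by (rule card_image_le)
  finally show ?thesis .
qed

text \<open>In every triangle on \<open>x y\<close>, contracting \<open>x y\<close> identifies the two other sides.\<close>

definition lost_edges :: "'a \<Rightarrow> 'a \<Rightarrow> 'a rel \<Rightarrow> 'a rel" where
  "lost_edges x y E = (let D = E `` {x} \<inter> E `` {y} in {(x, y), (y, x)} \<union> ({y} \<times> D \<union> D \<times> {y}))"

lemma finite_lost_edges: "finite E \<Longrightarrow> finite (lost_edges x y E)"
  by (simp add: lost_edges_def Let_def)

lemma card_lost_edges_le: "card (lost_edges x y E) \<le> 2 + 2 * card (E `` {x} \<inter> E `` {y})"
proof -
  let ?D = "E `` {x} \<inter> E `` {y}"
  have "card (lost_edges x y E) \<le> card {(x, y), (y, x)} + (card ({y} \<times> ?D) + card (?D \<times> {y}))"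
    unfolding lost_edges_def Let_def by (intro order_trans[OF card_Un_le] add_left_mono card_Un_le)
  moreover have "card ({y} \<times> ?D) = card ?D" "card (?D \<times> {y}) = card ?D"
    by (simp_all add: card_cartesian_product)
  moreover have "card {(x, y), (y, x)} \<le> 2"
    by (cases "x = y") auto
  ultimately show ?thesis by linarith
qed

lemma inj_on_contraction:
  fixes x y :: 'a and E :: "'a rel"
  assumes E: "sym E" "irrefl E"
  defines "\<phi> \<equiv> id(y := x)"
  shows "inj_on (map_prod \<phi> \<phi>) (E - lost_edges x y E)"
    and "map_prod \<phi> \<phi> ` (E - lost_edges x y E) \<subseteq> contract x y E"
proof -
  let ?K = "E - lost_edges x y E"
  have edge: "u \<noteq> v" "(v, u) \<in> E" if "(u, v) \<in> E" for u v
    using that E by (auto simp: irrefl_def dest: symD)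
  have merged: "u = v \<or> u = x \<and> v = y \<or> u = y \<and> v = x" if "\<phi> u = \<phi> v" for u v
    using that by (simp add: \<phi>_def split: if_splits)
  show "inj_on (map_prod \<phi> \<phi>) ?K"
  proof (rule inj_onI)
    have flip: "(v, u) \<in> ?K" if "(u, v) \<in> ?K" for u v
      using that edge by (auto simp: lost_edges_def Let_def)
    have clash: False if "(x, v) \<in> ?K" "(y, v') \<in> ?K" "\<phi> v = \<phi> v'" for v v'
      using merged[OF that(3)] that(1,2) edge by (elim disjE) (auto simp: lost_edges_def Let_def)
    fix p q assume pq: "p \<in> ?K" "q \<in> ?K" "map_prod \<phi> \<phi> p = map_prod \<phi> \<phi> q"
    obtain u v u' v' where uv: "p = (u, v)" "q = (u', v')" by fastforce
    have eq: "\<phi> u = \<phi> u'" "\<phi> v = \<phi> v'"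
      using pq(3) unfolding uv by simp_all
    have "u = u'"
      using merged[OF eq(1)] clash[OF _ _ eq(2)] clash[OF _ _ eq(2)[symmetric]] pq(1,2)
      unfolding uv by blast
    moreover have "v = v'"
      using merged[OF eq(2)] clash[OF flip flip eq(1)]
        clash[OF flip flip eq(1)[symmetric]] pq(1,2)
      unfolding uv by blast
    ultimately show "p = q" by (simp add: uv)
  qed
  show "map_prod \<phi> \<phi> ` ?K \<subseteq> contract x y E"
  proof (rule image_subsetI)
    fix p assume p: "p \<in> ?K"
    obtain u v where uv: "p = (u, v)" by fastforce
    have "\<phi> u \<noteq> \<phi> v"
      using p merged[of u v] edge(1)[of u v] by (auto simp: uv lost_edges_def Let_def)
    then show "map_prod \<phi> \<phi> p \<in> contract x y E"
      unfolding contract_def \<phi>_def[symmetric] using p by (auto simp: uv)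
  qed
qed

lemma card_le_contract:
  assumes "finite E" "sym E" "irrefl E"
  shows "card E \<le> card (contract x y E) + 2 + 2 * card (E `` {x} \<inter> E `` {y})"
proof -
  have "card (E - lost_edges x y E) \<le> card (contract x y E)"
    using inj_on_contraction[OF assms(2,3)]
    by (rule card_inj_on_le) (simp add: contract_def assms(1))
  moreover have "card E \<le> card (E - lost_edges x y E) + card (lost_edges x y E)"
    using diff_card_le_card_Diff[OF finite_lost_edges[OF assms(1)], of E x y] by linarith
  ultimately show ?thesis
    using card_lost_edges_le[of x y E] by linarith
qed

lemma card_eq_sum_degrees:
  assumes "finite W" "E \<subseteq> W \<times> W"
  shows "card E = (\<Sum>x\<in>W. card (E `` {x}))"
proof -
  have "E = Sigma W (\<lambda>x. E `` {x})" using assms(2) by auto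
  moreover have "finite E" using assms finite_subset by blast
  ultimately show ?thesis
    using card_SigmaI[OF assms(1), of "\<lambda>x. E `` {x}"] finite_Image by metis
qed

lemma exists_degree_le:
  assumes W: "finite W" "E \<subseteq> W \<times> W" and few: "card E < Suc d * card W"
  shows "\<exists>x\<in>W. card (E `` {x}) \<le> d"
proof (rule ccontr)
  assume "\<not> ?thesis"
  then have "\<And>x. x \<in> W \<Longrightarrow> Suc d \<le> card (E `` {x})" by (simp add: not_le Suc_le_eq)
  then have "Suc d * card W \<le> (\<Sum>x\<in>W. card (E `` {x}))"
    using sum_bounded_below[of W "Suc d" "\<lambda>x. card (E `` {x})"] by (simp add: mult.commute)
  then show False using few card_eq_sum_degrees[OF W] by simp
qed

lemma card_delete_edge:
  assumes "finite E" "(x, y) \<in> E" "(y, x) \<in> E" "x \<noteq> y"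
  shows "card (E - {(x, y), (y, x)}) + 2 = card E"
  using assms card_mono[of E "{(x, y), (y, x)}"] by (simp add: card_Diff_subset)

text \<open>Two neighbours of \<open>x\<close> have three common neighbours inside the neighbourhood of \<open>x\<close>.\<close>

lemma K33_minor_of_dense_neighbourhood:
  assumes E: "sym E" "irrefl E"
    and N: "E `` {x} \<noteq> {}" "finite (E `` {x})" "card (E `` {x}) \<le> 7"
    and dense: "\<And>a. a \<in> E `` {x} \<Longrightarrow> 4 \<le> card (E `` {x} \<inter> E `` {a})"
  shows "minor K33 E"
proof -
  define N where "N = (\<lambda>a. E `` {x} \<inter> E `` {a})"
  have finite_N: "finite (N a)" for a using N(2) by (simp add: N_def)
  obtain a where a: "a \<in> E `` {x}" using N(1) by blast
  obtain b where b: "b \<in> E `` {x}" "a \<noteq> b" "3 \<le> card (N a \<inter> N b)"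
  proof (cases "E `` {x} \<subseteq> insert a (E `` {a})")
    case True
    have "N a \<noteq> {}" using dense[OF a] by (auto simp: N_def)
    then obtain b where b: "b \<in> N a" by blast
    then have "a \<noteq> b" using E(2) by (auto simp: N_def irrefl_def)
    have "N b \<subseteq> insert a (N a \<inter> N b)" using True by (auto simp: N_def)
    then have "card (N b) \<le> card (insert a (N a \<inter> N b))" by (intro card_mono) (use finite_N in auto)
    also have "\<dots> \<le> Suc (card (N a \<inter> N b))" by (simp add: card_insert_if finite_N)
    finally have "3 \<le> card (N a \<inter> N b)" using dense[of b] b by (auto simp: N_def)
    then show ?thesis using that[of b] b \<open>a \<noteq> b\<close> by (auto simp: N_def)
  next
    case False
    then obtain b where b: "b \<in> E `` {x}" "b \<noteq> a" "(a, b) \<notin> E" by blast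
    have "N a \<union> N b \<subseteq> E `` {x} - {a, b}" using b E by (auto simp: N_def irrefl_def dest: symD)
    then have "card (N a \<union> N b) \<le> card (E `` {x} - {a, b})" by (intro card_mono) (use N(2) in auto)
    also have "\<dots> \<le> 5" using a b N(2,3) by (simp add: card_Diff_subset)
    finally have "3 \<le> card (N a \<inter> N b)"
      using card_Un_Int[OF finite_N finite_N, of a b] dense[OF a] dense[OF b(1)]
      by (simp add: N_def)
    then show ?thesis using that[of b] b by auto
  qed
  show ?thesis
    by (rule K33_minor_of_hubs[of E "N a \<inter> N b" "{x}" "{a}" "{b}"])
      (use E a b in \<open>auto simp: N_def irrefl_def connected_in_singleton\<close>)
qed

lemma (in K33_minor_free) exists_isolated_or_sparse_edge:
  assumes W: "finite W" "E \<subseteq> W \<times> W" and few: "card E < 8 * card W"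
  obtains x where "x \<in> W" "E `` {x} = {}"
  | x a where "x \<in> W" "(x, a) \<in> E" "card (E `` {x} \<inter> E `` {a}) \<le> 3"
proof -
  obtain x where x: "x \<in> W" "card (E `` {x}) \<le> 7"
    using exists_degree_le[OF W, of 7] few by auto
  have "finite (E `` {x})"
    using finite_subset[OF W(2)] W(1) by simp
  then have "E `` {x} = {} \<or> (\<exists>a\<in>E `` {x}. \<not> 4 \<le> card (E `` {x} \<inter> E `` {a}))"
    using K33_minor_of_dense_neighbourhood[OF sym irrefl] x(2) no_K33_minor by blast
  then show thesis
    using that x(1) by force
qed

theorem (in K33_minor_free) card_edges_le:
  assumes "finite W" "W \<noteq> {}" "E \<subseteq> W \<times> W"
  shows "card E + 4 \<le> 8 * card W"
  using assms K33_minor_free_axioms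
proof (induction "card W + card E" arbitrary: W E rule: less_induct)
  case less
  interpret K33_minor_free E by (rule less.prems(4))
  have W: "finite W" "W \<noteq> {}" "E \<subseteq> W \<times> W" by (rule less.prems)+
  then have finite_E: "finite E" and pos: "0 < card W"
    using finite_subset[OF W(3)] by (simp_all add: card_gt_0_iff)
  have smaller: "card F + 4 \<le> 8 * card X"
    if "K33_minor_free F" "F \<subseteq> X \<times> X" "X \<subseteq> W" "X \<noteq> {}" "card X + card F < card W + card E" for F X
    using less.hyps that W(1) finite_subset by blast
  show ?case
  proof (cases "E = {}")
    case False
    then obtain u v where uv: "(u, v) \<in> E" by auto
    let ?F = "E - {(u, v), (v, u)}"
    have "K33_minor_free ?F" by (rule K33_minor_free_subgraph) (use sym in \<open>auto simp: sym_def\<close>)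
    moreover have F: "card ?F + 2 = card E"
      using card_delete_edge[OF finite_E uv] edge_sym[OF uv] edge_irrefl[OF uv] by blast
    ultimately have "card ?F + 4 \<le> 8 * card W" using W by (intro smaller) auto
    then have "card E < 8 * card W" using F by linarith
    with W(1,3) show ?thesis
    proof (rule exists_isolated_or_sparse_edge)
      fix x assume x: "x \<in> W" "E `` {x} = {}"
      then have "E \<subseteq> (W - {x}) \<times> (W - {x})" using W(3) edge_sym by blast
      then have "card E + 4 \<le> 8 * card (W - {x})"
        using W(1) x pos uv by (intro smaller K33_minor_free_axioms) auto
      then show ?thesis using W(1) x by simp
    next
      fix x a assume xa: "x \<in> W" "(x, a) \<in> E" and sparse: "card (E `` {x} \<inter> E `` {a}) \<le> 3"
      have a: "a \<in> W" "x \<noteq> a" using xa(2) W(3) edge_irrefl by auto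
      have "card (contract x a E) + 4 \<le> 8 * card (W - {a})"
        using card_contract_le[OF finite_E, of x a] W(1) xa(1) a pos
        by (intro smaller K33_minor_free_contract xa(2) contract_subset[OF W(3) xa(2) a(2)]) auto
      then show ?thesis
        using card_le_contract[OF finite_E sym irrefl, of x a] sparse W(1) a(1) pos by simp
    qed
  qed (use pos in simp)
qed

section \<open>Sets whose vertices are pairwise at distance at most two\<close>

definition reach_avoiding :: "'a rel \<Rightarrow> 'a set \<Rightarrow> 'a \<Rightarrow> 'a set" where
  "reach_avoiding E X u = E `` insert u (E `` {u} - X) - {u}"

lemma mem_reach_avoiding_iff:
  "v \<in> reach_avoiding E X u \<longleftrightarrow> v \<noteq> u \<and> ((u, v) \<in> E \<or> (\<exists>w. w \<notin> X \<and> (u, w) \<in> E \<and> (w, v) \<in> E))"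
  by (auto simp: reach_avoiding_def)

lemma reach_avoiding_sym: "sym E \<Longrightarrow> v \<in> reach_avoiding E X u \<Longrightarrow> u \<in> reach_avoiding E X v"
  by (auto simp: mem_reach_avoiding_iff dest: symD)

lemma reach_avoiding_antimono: "X \<subseteq> Y \<Longrightarrow> reach_avoiding E Y u \<subseteq> reach_avoiding E X u"
  by (auto simp: reach_avoiding_def)

lemma card_UN_le_mult:
  assumes "finite I" "\<And>i. i \<in> I \<Longrightarrow> card (A i) \<le> k"
  shows "card (\<Union>i\<in>I. A i) \<le> card I * k"
  using card_UN_le[OF assms(1), of A] sum_bounded_above[of I "\<lambda>i. card (A i)" k] assms(2)
  by simp

context K33_minor_free
begin

lemma card_two_hubs_reach_le:
  assumes "y \<noteq> z" "u \<noteq> y" "u \<noteq> z" and T: "T \<subseteq> E `` {y} \<inter> E `` {z} \<inter> reach_avoiding E ({y, z} \<union> T) u"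
  shows "card T \<le> 2"
proof (rule ccontr)
  assume "\<not> card T \<le> 2"
  let ?Z = "insert u (E `` {u} - ({y, z} \<union> T))"
  have "minor K33 E"
  proof (rule K33_minor_of_hubs[OF sym])
    show "3 \<le> card T" using \<open>\<not> card T \<le> 2\<close> by simp
    show "T \<subseteq> E `` {y} \<inter> E `` {z} \<inter> E `` ?Z" "T \<inter> ({y} \<union> {z} \<union> ?Z) = {}"
      using T edge_irrefl by (auto simp: reach_avoiding_def)
    show "connected_in E ?Z" by (rule connected_in_star[OF sym]) blast
  qed (use assms in \<open>auto simp: connected_in_singleton\<close>)
  then show False using no_K33_minor by blast
qed

lemma card_common_neighbours_reach_le:
  assumes "y \<noteq> z" "u \<noteq> y" "u \<noteq> z" "B \<subseteq> E `` {y} \<inter> E `` {z}"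
  shows "card (B \<inter> reach_avoiding E ({y, z} \<union> B) u) \<le> 2"
proof (rule card_two_hubs_reach_le[OF assms(1-3)])
  have "reach_avoiding E ({y, z} \<union> B) u
    \<subseteq> reach_avoiding E ({y, z} \<union> (B \<inter> reach_avoiding E ({y, z} \<union> B) u)) u"
    by (rule reach_avoiding_antimono) blast
  then show "B \<inter> reach_avoiding E ({y, z} \<union> B) u \<subseteq>
      E `` {y} \<inter> E `` {z} \<inter> reach_avoiding E ({y, z} \<union> (B \<inter> reach_avoiding E ({y, z} \<union> B) u)) u"
    using assms(4) by blast
qed

lemma card_common_neighbours_pairwise_reached_le_5:
  assumes yz: "y \<noteq> z" and C: "finite C" "C \<subseteq> E `` {y} \<inter> E `` {z}"
    and reached: "\<And>u. u \<in> C \<Longrightarrow> C \<subseteq> insert u (reach_avoiding E {y, z} u)"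
  shows "card C \<le> 5"
proof (cases "C = {}")
  case False
  then obtain c where c: "c \<in> C" by blast
  define D where "D = (\<lambda>u. C \<inter> reach_avoiding E ({y, z} \<union> C) u)"
  have finite_D: "finite (D u)" for u using C(1) by (simp add: D_def)
  have at_most_two: "card (D u) \<le> 2" if "u \<in> C" for u
    unfolding D_def using that C(2) edge_irrefl
    by (intro card_common_neighbours_reach_le[OF yz _ _ C(2)]) blast+
  have D_sym: "u \<in> D w" if "w \<in> D u" "u \<in> C" for u w
    using that reach_avoiding_sym[OF sym] by (simp add: D_def)
  have "C \<subseteq> insert c (D c \<union> (\<Union>w\<in>D c. D w - {c}))"
  proof
    fix v assume v: "v \<in> C"
    show "v \<in> insert c (D c \<union> (\<Union>w\<in>D c. D w - {c}))"
    proof (cases "v = c \<or> v \<in> D c")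
      case False
      then obtain w where w: "w \<noteq> y" "w \<noteq> z" "(c, w) \<in> E" "(w, v) \<in> E"
        using reached[OF c] v by (auto simp: D_def mem_reach_avoiding_iff subset_iff)
      then have "w \<in> C" using False v by (auto simp: D_def mem_reach_avoiding_iff)
      then have "w \<in> D c" "v \<in> D w"
        using w v edge_irrefl by (auto simp: D_def mem_reach_avoiding_iff)
      then show ?thesis using False by blast
    qed blast
  qed
  then have "card C \<le> card (insert c (D c \<union> (\<Union>w\<in>D c. D w - {c})))"
    by (intro card_mono) (use finite_D in auto)
  also have "\<dots> \<le> Suc (card (D c) + card (\<Union>w\<in>D c. D w - {c}))"
    using card_Un_le[of "D c" "\<Union>w\<in>D c. D w - {c}"] by (simp add: card_insert_if finite_D)
  also have "card (\<Union>w\<in>D c. D w - {c}) \<le> card (D c) * 1"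
  proof (rule card_UN_le_mult[OF finite_D])
    fix w assume w: "w \<in> D c"
    then have "w \<in> C" "c \<in> D w" using D_sym[OF w c] by (auto simp: D_def)
    then show "card (D w - {c}) \<le> 1" using at_most_two[of w] finite_D by simp
  qed
  finally show ?thesis using at_most_two[OF c] by simp
qed simp

end

locale K33_minor_free_cone = K33_minor_free +
  fixes y :: 'a and Q :: "'a set"
  assumes finite_base: "finite Q" and base: "Q \<subseteq> E `` {y}"
    and base_reached: "u \<in> Q \<Longrightarrow> Q \<subseteq> insert u (reach_avoiding E {y} u)"
begin

abbreviation base_nbrs :: "'a \<Rightarrow> 'a set" where
  "base_nbrs z \<equiv> Q \<inter> E `` {z}"

lemma apex_notin_base: "y \<notin> Q"
  using base edge_irrefl by blast

definition two_steps_in_base :: "'a \<Rightarrow> 'a set" where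
  "two_steps_in_base x = (\<Union>w\<in>base_nbrs x. base_nbrs w - {x})"

lemma card_two_steps_in_base_le_2:
  assumes few: "\<And>z. z \<noteq> y \<Longrightarrow> card (base_nbrs z) \<le> 2" and x: "x \<in> Q"
  shows "card (two_steps_in_base x) \<le> 2"
proof -
  have "card (base_nbrs w - {x}) \<le> 1" if w: "w \<in> base_nbrs x" for w
  proof -
    have "w \<noteq> y" "x \<in> base_nbrs w" using w x apex_notin_base edge_sym by auto
    then show ?thesis using few[of w] finite_base by simp
  qed
  then have "card (two_steps_in_base x) \<le> card (base_nbrs x) * 1"
    unfolding two_steps_in_base_def by (intro card_UN_le_mult) (use finite_base in auto)
  then show ?thesis using few[of x] x apex_notin_base by fastforce
qed

lemma reach_outside_two_steps:
  assumes "x \<in> Q" "t \<in> Q" "t \<noteq> x" "t \<notin> two_steps_in_base x"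
  obtains "(x, t) \<in> E" | w where "w \<noteq> y" "w \<notin> Q" "(x, w) \<in> E" "(w, t) \<in> E"
proof -
  have "t \<in> reach_avoiding E {y} x"
    using assms base_reached[of x] by blast
  then consider "(x, t) \<in> E" | w where "w \<noteq> y" "(x, w) \<in> E" "(w, t) \<in> E"
    by (auto simp: mem_reach_avoiding_iff)
  then show thesis
  proof cases
    case (2 w)
    then have "w \<notin> Q" using assms by (auto simp: two_steps_in_base_def)
    then show ?thesis using that(2) 2 by blast
  qed (rule that(1))
qed

lemma card_base_le_8:
  assumes few: "\<And>z. z \<noteq> y \<Longrightarrow> card (base_nbrs z) \<le> 2"
  shows "card Q \<le> 8"
proof (rule ccontr)
  assume many: "\<not> card Q \<le> 8"
  then obtain a b where ab: "a \<in> Q" "b \<in> Q" "a \<noteq> b"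
    using card_le_Suc0_iff_eq[OF finite_base] by fastforce
  let ?near = "{a, b} \<union> (two_steps_in_base a \<union> two_steps_in_base b)"
  define T where "T = Q - ?near"
  have "card ?near \<le> card {a, b} + (card (two_steps_in_base a) + card (two_steps_in_base b))"
    by (intro order_trans[OF card_Un_le] add_left_mono card_Un_le)
  also have "\<dots> \<le> 2 + (2 + 2)"
    by (intro add_mono card_two_steps_in_base_le_2 few ab) (use ab in simp)
  finally have "3 \<le> card T"
    unfolding T_def using diff_card_le_card_Diff[of ?near Q] finite_base many
    by (simp add: two_steps_in_base_def)
  define H where "H = (\<lambda>x. {w. w \<noteq> y \<and> w \<notin> Q \<and> (x, w) \<in> E \<and> E `` {w} \<inter> T \<noteq> {}})"
  have reached: "T \<subseteq> E `` insert x (H x)" if x: "x \<in> {a, b}" for x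
  proof
    fix t assume t: "t \<in> T"
    then have "x \<in> Q" "t \<in> Q" "t \<noteq> x" "t \<notin> two_steps_in_base x"
      using x ab by (auto simp: T_def)
    then show "t \<in> E `` insert x (H x)"
      by (rule reach_outside_two_steps) (use t in \<open>auto simp: H_def\<close>)
  qed
  have "w \<notin> H b" if "w \<in> H a" for w
  proof
    assume "w \<in> H b"
    then obtain t where w: "w \<noteq> y" "(a, w) \<in> E" "(b, w) \<in> E" and t: "(w, t) \<in> E" "t \<in> T"
      using \<open>w \<in> H a\<close> by (auto simp: H_def)
    then have "{a, b, t} \<subseteq> base_nbrs w" using edge_sym ab by (auto simp: T_def)
    then have "card {a, b, t} \<le> card (base_nbrs w)" by (intro card_mono) (use finite_base in simp)
    moreover have "card {a, b, t} = 3" using ab t by (auto simp: card_3_iff T_def)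
    ultimately show False using few[OF w(1)] by simp
  qed
  then have "minor K33 E"
    by (intro K33_minor_of_hubs[OF sym \<open>3 \<le> card T\<close>, of "{y}" "insert a (H a)" "insert b (H b)"]
        connected_in_star[OF sym] connected_in_singleton)
      (use ab reached base apex_notin_base in \<open>auto simp: H_def T_def\<close>)
  then show False using no_K33_minor by blast
qed

definition outer_reach :: "'a \<Rightarrow> 'a \<Rightarrow> 'a set" where
  "outer_reach z u = base_nbrs z \<inter> reach_avoiding E ({y, z} \<union> base_nbrs z) u"

lemma finite_outer_reach: "finite (outer_reach z u)"
  using finite_base by (simp add: outer_reach_def)

context
  fixes z u :: 'a
  assumes zy: "z \<noteq> y" and u: "u \<in> Q" "u \<noteq> z" "(z, u) \<notin> E"
begin

lemma card_outer_reach_le_2: "card (outer_reach z u) \<le> 2"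
  unfolding outer_reach_def
  by (rule card_common_neighbours_reach_le) (use zy u base apex_notin_base in auto)

lemma missed_base_nbr_via_outer_reach:
  assumes b: "b \<in> base_nbrs z" "b \<notin> outer_reach z u"
  obtains w where "w \<in> outer_reach z u" "(u, w) \<in> E" "(w, b) \<in> E"
proof -
  have missed: "b \<notin> reach_avoiding E ({y, z} \<union> base_nbrs z) u"
    using b by (simp add: outer_reach_def)
  moreover have "b \<in> reach_avoiding E {y} u"
    using u b base_reached[of u] by auto
  ultimately obtain w where w: "w \<noteq> y" "(u, w) \<in> E" "(w, b) \<in> E"
    by (auto simp: mem_reach_avoiding_iff)
  have "w \<noteq> z" using w(2) u(3) edge_sym by blast
  then have "w \<in> base_nbrs z"
    using missed u b w by (auto simp: mem_reach_avoiding_iff)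
  then have "w \<in> outer_reach z u"
    using w(2) edge_irrefl by (auto simp: outer_reach_def mem_reach_avoiding_iff)
  then show thesis using that w by blast
qed

lemma card_missed_via_le:
  assumes w: "w \<in> outer_reach z u" "(u, w) \<in> E"
  shows "card (base_nbrs z \<inter> E `` {w} - outer_reach z u) \<le> 3 - card (outer_reach z u)"
proof -
  let ?T = "outer_reach z u" and ?X = "base_nbrs z \<inter> E `` {w} - outer_reach z u"
  have "card ((?T - {w}) \<union> ?X) \<le> 2"
  proof (rule card_two_hubs_reach_le[OF zy[symmetric] _ u(2)])
    show "u \<noteq> y" using u apex_notin_base by blast
    have "?T - {w} \<subseteq> reach_avoiding E ({y, z} \<union> ((?T - {w}) \<union> ?X)) u"
      using reach_avoiding_antimono[of "{y, z} \<union> ((?T - {w}) \<union> ?X)" "{y, z} \<union> base_nbrs z" E u]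
      by (auto simp: outer_reach_def)
    moreover have "w \<in> base_nbrs z" "w \<notin> ?X" "u \<notin> ?X"
      using w u edge_irrefl by (auto simp: outer_reach_def)
    then have "?X \<subseteq> reach_avoiding E ({y, z} \<union> ((?T - {w}) \<union> ?X)) u"
      using w(2) apex_notin_base edge_irrefl unfolding reach_avoiding_def by blast
    ultimately show "(?T - {w}) \<union> ?X
      \<subseteq> E `` {y} \<inter> E `` {z} \<inter> reach_avoiding E ({y, z} \<union> ((?T - {w}) \<union> ?X)) u"
      using base by (auto simp: outer_reach_def)
  qed
  moreover have "card ((?T - {w}) \<union> ?X) = card ?T - 1 + card ?X"
    using w finite_base finite_outer_reach by (subst card_Un_disjoint) auto
  moreover have "0 < card ?T"
    using w(1) finite_outer_reach by (auto simp: card_gt_0_iff)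
  ultimately show ?thesis by linarith
qed

lemma card_base_nbrs_le_4: "card (base_nbrs z) \<le> 4"
proof -
  let ?T = "outer_reach z u"
  let ?W = "?T \<inter> E `` {u}" and ?X = "\<lambda>w. base_nbrs z \<inter> E `` {w} - ?T"
  have fin: "finite ?W" "finite (?X w)" for w using finite_base finite_outer_reach by simp_all
  have "base_nbrs z \<subseteq> ?T \<union> (\<Union>w\<in>?W. ?X w)"
  proof
    fix b assume b: "b \<in> base_nbrs z"
    show "b \<in> ?T \<union> (\<Union>w\<in>?W. ?X w)"
    proof (cases "b \<in> ?T")
      case False
      then obtain w where "w \<in> ?T" "(u, w) \<in> E" "(w, b) \<in> E"
        using missed_base_nbr_via_outer_reach[OF b] by blast
      then show ?thesis using b False by blast
    qed blast
  qed
  then have "card (base_nbrs z) \<le> card (?T \<union> (\<Union>w\<in>?W. ?X w))"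
    by (intro card_mono) (use finite_base finite_outer_reach in auto)
  also have "\<dots> \<le> card ?T + card (\<Union>w\<in>?W. ?X w)" by (rule card_Un_le)
  also have "card (\<Union>w\<in>?W. ?X w) \<le> card ?W * (3 - card ?T)"
    by (intro card_UN_le_mult fin card_missed_via_le) auto
  also have "card ?W * (3 - card ?T) \<le> card ?T * (3 - card ?T)"
    by (intro mult_right_mono card_mono finite_outer_reach) auto
  also have "card ?T + card ?T * (3 - card ?T) \<le> 4"
  proof -
    consider "card ?T = 0" | "card ?T = 1" | "card ?T = 2" using card_outer_reach_le_2 by linarith
    then show ?thesis by cases simp_all
  qed
  finally show ?thesis by simp
qed

end

lemma base_subset_nbrs_of_nbrs:
  assumes z: "z \<noteq> y" and many: "3 \<le> card (base_nbrs z)"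
  defines "W \<equiv> {w \<in> base_nbrs z. base_nbrs z \<inter> E `` {w} \<noteq> {}}"
  shows "Q - insert z (base_nbrs z) \<subseteq> (\<Union>w\<in>W. base_nbrs w - base_nbrs z)"
proof
  fix u assume "u \<in> Q - insert z (base_nbrs z)"
  then have u: "u \<in> Q" "u \<noteq> z" "(z, u) \<notin> E" by auto
  have "\<not> base_nbrs z \<subseteq> outer_reach z u"
    using card_mono[OF finite_outer_reach, of "base_nbrs z" z u] card_outer_reach_le_2[OF z u] many
    by linarith
  then obtain b where b: "b \<in> base_nbrs z" "b \<notin> outer_reach z u" by blast
  then obtain w where "w \<in> outer_reach z u" "(u, w) \<in> E" "(w, b) \<in> E"
    using missed_base_nbr_via_outer_reach[OF z u] by blast
  then show "u \<in> (\<Union>w\<in>W. base_nbrs w - base_nbrs z)"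
    using u b(1) edge_sym by (auto simp: outer_reach_def W_def)
qed

lemma card_base_le_17:
  assumes z: "z \<noteq> y" and max: "\<And>z'. z' \<noteq> y \<Longrightarrow> card (base_nbrs z') \<le> card (base_nbrs z)"
    and B: "3 \<le> card (base_nbrs z)" "card (base_nbrs z) \<le> 4"
  shows "card Q \<le> 17"
proof -
  let ?B = "base_nbrs z"
  define U where "U = Q - insert z ?B"
  define W where "W = {w \<in> ?B. ?B \<inter> E `` {w} \<noteq> {}}"
  have fin: "finite ?B" "finite W" "finite U" using finite_base by (simp_all add: W_def U_def)
  have "U \<subseteq> (\<Union>w\<in>W. base_nbrs w - ?B)"
    unfolding U_def W_def by (rule base_subset_nbrs_of_nbrs[OF z B(1)])
  then have "card U \<le> card (\<Union>w\<in>W. base_nbrs w - ?B)"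
    by (intro card_mono) (use finite_base fin in auto)
  also have "\<dots> \<le> card W * 3"
  proof (rule card_UN_le_mult[OF fin(2)])
    fix w assume "w \<in> W"
    then obtain b where b: "b \<in> ?B" "b \<in> base_nbrs w" and "w \<noteq> y"
      using apex_notin_base by (auto simp: W_def)
    have "card (base_nbrs w - ?B) \<le> card (base_nbrs w - {b})"
      by (intro card_mono) (use finite_base b in auto)
    also have "\<dots> \<le> 3" using max[OF \<open>w \<noteq> y\<close>] B(2) b finite_base by simp
    finally show "card (base_nbrs w - ?B) \<le> 3" .
  qed
  also have "card W \<le> card ?B"
    by (rule card_mono[OF fin(1)]) (auto simp: W_def)
  finally have "card U \<le> 12" using B(2) by simp
  have "card Q \<le> card (insert z (?B \<union> U))"
    by (intro card_mono) (use fin in \<open>auto simp: U_def\<close>)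
  also have "\<dots> \<le> Suc (card ?B + card U)"
    using card_Un_le[of ?B U] fin by (simp add: card_insert_if)
  finally show ?thesis using B(2) \<open>card U \<le> 12\<close> by simp
qed

theorem card_base_le_17_or_second_apex: "card Q \<le> 17 \<or> (\<exists>z. z \<noteq> y \<and> Q \<subseteq> insert z (E `` {z}))"
proof (cases "Q = {}")
  case False
  then obtain q where "q \<in> Q" by blast
  have "\<exists>z. z \<noteq> y \<and> (\<forall>z'. z' \<noteq> y \<longrightarrow> card (base_nbrs z') \<le> card (base_nbrs z))"
    by (rule ex_has_greatest_nat[of _ q _ "Suc (card Q)"])
      (use finite_base \<open>q \<in> Q\<close> apex_notin_base in \<open>auto simp: less_Suc_eq_le intro!: card_mono\<close>)
  then obtain z where z: "z \<noteq> y"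
    and max: "\<And>z'. z' \<noteq> y \<Longrightarrow> card (base_nbrs z') \<le> card (base_nbrs z)" by blast
  show ?thesis
  proof (cases "Q \<subseteq> insert z (E `` {z})")
    case True
    then show ?thesis using z by blast
  next
    case False
    then have at_most_four: "card (base_nbrs z) \<le> 4" using card_base_nbrs_le_4[OF z] by blast
    show ?thesis
    proof (cases "card (base_nbrs z) \<le> 2")
      case True
      then have "card Q \<le> 8" using card_base_le_8 max order_trans by blast
      then show ?thesis by simp
    next
      case False
      then show ?thesis using card_base_le_17[OF z max] at_most_four by simp
    qed
  qed
qed simp

end

section \<open>Relative cliques\<close>

definition adj :: "mgraph \<Rightarrow> nat rel" where
  "adj G = {(u, v). lab G u v \<noteq> None}"

text \<open>Both types are read off at the middle vertex \<open>w\<close>, so a directed 2-path is special.\<close>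

definition special_pairs :: "mgraph \<Rightarrow> nat \<Rightarrow> nat rel" where
  "special_pairs G w = {(u, v). (w, u) \<in> adj G \<and> (w, v) \<in> adj G \<and> lab G w u \<noteq> lab G w v}"

definition adjtypes :: "nat \<Rightarrow> nat \<Rightarrow> adjtype set" where
  "adjtypes m n = Fwd ` {..<m} \<union> Bwd ` {..<m} \<union> Edg ` {..<n}"

lemma finite_adjtypes: "finite (adjtypes m n)"
  by (simp add: adjtypes_def)

lemma card_adjtypes: "card (adjtypes m n) = 2 * m + n"
proof -
  have "card (adjtypes m n) = card (Fwd ` {..<m}) + card (Bwd ` {..<m}) + card (Edg ` {..<n})"
    unfolding adjtypes_def by (subst card_Un_disjoint, simp, simp, force)+ simp
  then show ?thesis
    by (simp add: card_image inj_on_def)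
qed

lemma flip_adj_in_adjtypes: "flip_adj t \<in> adjtypes m n \<longleftrightarrow> t \<in> adjtypes m n"
  by (cases t) (auto simp: adjtypes_def)

lemma flip_adj_flip_adj [simp]: "flip_adj (flip_adj t) = t"
  by (cases t) auto

lemma colored_mixed_graph_iff:
  "colored_mixed_graph m n G \<longleftrightarrow> finite (verts G) \<and> adj G \<subseteq> verts G \<times> verts G \<and> irrefl (adj G) \<and>
     (\<forall>u v. lab G v u = map_option flip_adj (lab G u v)) \<and>
     (\<forall>u v t. lab G u v = Some t \<longrightarrow> t \<in> adjtypes m n)"
proof -
  have "(\<forall>u v i. lab G u v = Some (Fwd i) \<longrightarrow> i < m) \<and> (\<forall>u v j. lab G u v = Some (Edg j) \<longrightarrow> j < n) \<longleftrightarrow>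
      (\<forall>u v t. lab G u v = Some t \<longrightarrow> t \<in> adjtypes m n)" (is "?bounded \<longleftrightarrow> ?types")
    if flip: "\<forall>u v. lab G v u = map_option flip_adj (lab G u v)"
  proof
    assume bounded: ?bounded
    show ?types
    proof (intro allI impI)
      fix u v t assume t: "lab G u v = Some t"
      then have "lab G v u = Some (flip_adj t)" using flip by (metis option.simps(9))
      then show "t \<in> adjtypes m n"
        using bounded t by (cases t) (auto simp: adjtypes_def)
    qed
  qed (auto simp: adjtypes_def)
  moreover have "(\<forall>u v. lab G u v \<noteq> None \<longrightarrow> u \<in> verts G \<and> v \<in> verts G \<and> u \<noteq> v) \<longleftrightarrow>
      adj G \<subseteq> verts G \<times> verts G \<and> irrefl (adj G)"
    unfolding adj_def irrefl_def by fast
  ultimately show ?thesis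
    unfolding colored_mixed_graph_def by argo
qed

lemma colored_mixed_graphD:
  assumes "colored_mixed_graph m n G"
  shows finite_verts: "finite (verts G)" and adj_subset_verts: "adj G \<subseteq> verts G \<times> verts G"
    and irrefl_adj: "irrefl (adj G)" and lab_flip: "lab G v u = map_option flip_adj (lab G u v)"
    and lab_in_adjtypes: "lab G u v = Some t \<Longrightarrow> t \<in> adjtypes m n"
  using assms unfolding colored_mixed_graph_iff by blast+

lemma sym_adj:
  assumes "colored_mixed_graph m n G"
  shows "sym (adj G)"
proof (rule symI)
  fix u v assume "(u, v) \<in> adj G"
  then show "(v, u) \<in> adj G"
    using lab_flip[OF assms, where u = u and v = v] by (simp add: adj_def)
qed

definition image_type :: "mgraph \<Rightarrow> (nat \<Rightarrow> nat) \<Rightarrow> nat \<Rightarrow> nat \<Rightarrow> adjtype \<Rightarrow> bool" where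
  "image_type G f x y t \<longleftrightarrow> (\<exists>a b. f a = x \<and> f b = y \<and> lab G a b = Some t)"

definition quotient_graph :: "mgraph \<Rightarrow> (nat \<Rightarrow> nat) \<Rightarrow> mgraph" where
  "quotient_graph G f = \<lparr>verts = f ` verts G,
     lab = \<lambda>x y. if \<exists>t. image_type G f x y t then Some (SOME t. image_type G f x y t) else None\<rparr>"

context
  fixes m n :: nat and G :: mgraph and f :: "nat \<Rightarrow> nat"
  assumes G: "colored_mixed_graph m n G"
    and compatible: "\<And>a b a' b'. f a = f a' \<Longrightarrow> f b = f b' \<Longrightarrow>
      (a, b) \<in> adj G \<Longrightarrow> (a', b') \<in> adj G \<Longrightarrow> lab G a b = lab G a' b'"
begin

lemma lab_quotient_graph_iff: "lab (quotient_graph G f) x y = Some t \<longleftrightarrow> image_type G f x y t"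
proof -
  have "t = t'" if "image_type G f x y t" "image_type G f x y t'" for t t'
    using that compatible unfolding image_type_def adj_def by fastforce
  then show ?thesis
    unfolding quotient_graph_def by simp (metis someI)
qed

lemma adj_quotient_graph: "adj (quotient_graph G f) = map_prod f f ` adj G"
proof -
  have "(x, y) \<in> adj (quotient_graph G f) \<longleftrightarrow> (\<exists>t. image_type G f x y t)" for x y
    by (simp add: adj_def lab_quotient_graph_iff)
  then show ?thesis
    by (force simp: adj_def image_type_def)
qed

lemma lab_quotient_graph_flip:
  "lab (quotient_graph G f) y x = map_option flip_adj (lab (quotient_graph G f) x y)"
proof -
  have flip: "lab (quotient_graph G f) y x = Some (flip_adj t)"
    if "lab (quotient_graph G f) x y = Some t" for x y t
    using that lab_flip[OF G] unfolding lab_quotient_graph_iff image_type_def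
    by (metis option.simps(9))
  show ?thesis
    using flip[of x y] flip[of y x]
    by (cases "lab (quotient_graph G f) x y"; cases "lab (quotient_graph G f) y x") auto
qed

lemma colored_mixed_graph_quotient:
  assumes "\<And>a b. (a, b) \<in> adj G \<Longrightarrow> f a \<noteq> f b"
  shows "colored_mixed_graph m n (quotient_graph G f)"
  unfolding colored_mixed_graph_iff
proof (intro conjI allI impI)
  show "finite (verts (quotient_graph G f))"
    using finite_verts[OF G] by (simp add: quotient_graph_def)
  show "adj (quotient_graph G f) \<subseteq> verts (quotient_graph G f) \<times> verts (quotient_graph G f)"
    using adj_subset_verts[OF G] unfolding adj_quotient_graph by (auto simp: quotient_graph_def)
  show "irrefl (adj (quotient_graph G f))"
    using assms unfolding adj_quotient_graph by (force simp: irrefl_def)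
  fix x y t assume "lab (quotient_graph G f) x y = Some t"
  then show "t \<in> adjtypes m n"
    using lab_in_adjtypes[OF G] unfolding lab_quotient_graph_iff image_type_def by blast
qed (rule lab_quotient_graph_flip)

lemma colored_hom_quotient: "colored_hom G (quotient_graph G f) f"
  unfolding colored_hom_def lab_quotient_graph_iff
  by (auto simp: quotient_graph_def image_type_def)

end

lemma colored_hom_lab: "colored_hom G H f \<Longrightarrow> (u, v) \<in> adj G \<Longrightarrow> lab H (f u) (f v) = lab G u v"
  by (auto simp: colored_hom_def adj_def)

lemma identifying_colored_hom:
  assumes G: "colored_mixed_graph m n G" and uv: "(u, v) \<notin> adj G" "\<And>w. (u, v) \<notin> special_pairs G w"
  obtains H where "colored_mixed_graph m n H" "colored_hom G H (id(v := u))"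
proof -
  let ?f = "id(v := u)"
  have loop: "(a, a) \<notin> adj G" for a
    using irrefl_adj[OF G] by (simp add: irrefl_def)
  have adj: "(b, a) \<in> adj G" if "(a, b) \<in> adj G" for a b
    using that sym_adj[OF G] by (rule symD[rotated])
  have merged: "a = a' \<or> {a, a'} = {u, v}" if "?f a = ?f a'" for a a'
    using that by (auto split: if_splits)
  have right: "lab G a u = lab G a v" if "(a, u) \<in> adj G" "(a, v) \<in> adj G" for a
    using that uv by (auto simp: special_pairs_def)
  then have left: "lab G u a = lab G v a" if "(u, a) \<in> adj G" "(v, a) \<in> adj G" for a
    using that adj lab_flip[OF G, of _ a] by metis
  have "lab G a b = lab G a' b'"
    if "?f a = ?f a'" "?f b = ?f b'" "(a, b) \<in> adj G" "(a', b') \<in> adj G" for a b a' b'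
    using merged[OF that(1)] merged[OF that(2)] that(3,4) right left loop adj uv(1)
    by (auto simp: doubleton_eq_iff)
  moreover have "?f a \<noteq> ?f b" if "(a, b) \<in> adj G" for a b
    using merged[of a b] that loop adj uv(1) by (auto simp: doubleton_eq_iff)
  ultimately show thesis
    using that[OF colored_mixed_graph_quotient[OF G] colored_hom_quotient[OF G]] by blast
qed

theorem relative_clique_iff:
  assumes G: "colored_mixed_graph m n G"
  shows "relative_clique m n G R \<longleftrightarrow> R \<subseteq> verts G \<and> R \<times> R \<subseteq> Id \<union> adj G \<union> (\<Union>w. special_pairs G w)"
proof (intro iffI conjI)
  assume R: "relative_clique m n G R"
  then show "R \<subseteq> verts G" by (simp add: relative_clique_def)
  show "R \<times> R \<subseteq> Id \<union> adj G \<union> (\<Union>w. special_pairs G w)"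
  proof clarify
    fix u v assume uv: "u \<in> R" "v \<in> R" "(u, v) \<notin> adj G" "(u, v) \<notin> (\<Union>w. special_pairs G w)"
    then obtain H where "colored_mixed_graph m n H" "colored_hom G H (id(v := u))"
      using identifying_colored_hom[OF G, of u v] by blast
    then have "inj_on (id(v := u)) R" using R by (simp add: relative_clique_def)
    then show "u = v" using uv by (auto simp: inj_on_def split: if_splits)
  qed
next
  assume R: "R \<subseteq> verts G \<and> R \<times> R \<subseteq> Id \<union> adj G \<union> (\<Union>w. special_pairs G w)"
  have "inj_on f R" if H: "colored_mixed_graph m n H" and f: "colored_hom G H f" for H f
  proof (rule inj_onI, rule ccontr)
    fix u v assume uv: "u \<in> R" "v \<in> R" "f u = f v" "u \<noteq> v"
    consider "(u, v) \<in> adj G" | w where "(u, v) \<in> special_pairs G w" using R uv by blast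
    then show False
    proof cases
      case 1
      then have "(f u, f v) \<in> adj H" using colored_hom_lab[OF f 1] by (simp add: adj_def)
      then show False using uv(3) irrefl_adj[OF H] by (simp add: irrefl_def)
    next
      case (2 w)
      then show False using colored_hom_lab[OF f, of w u] colored_hom_lab[OF f, of w v] uv(3)
        by (simp add: special_pairs_def)
    qed
  qed
  moreover have "R \<subseteq> verts G" using R by blast
  ultimately show "relative_clique m n G R" unfolding relative_clique_def by blast
qed

lemma finite_relative_clique_cards:
  assumes "colored_mixed_graph m n G"
  shows "finite {card R | R. relative_clique m n G R}"
proof (rule finite_subset)
  show "{card R | R. relative_clique m n G R} \<subseteq> card ` Pow (verts G)"
    by (auto simp: relative_clique_def)
  show "finite (card ` Pow (verts G))" using finite_verts[OF assms] by simp
qed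

lemma card_le_omega_r:
  assumes "colored_mixed_graph m n G" "relative_clique m n G R"
  shows "card R \<le> omega_r m n G"
  unfolding omega_r_def using assms by (intro Max_ge finite_relative_clique_cards) auto

lemma omega_r_le:
  assumes G: "colored_mixed_graph m n G" and bound: "\<And>R. relative_clique m n G R \<Longrightarrow> card R \<le> k"
  shows "omega_r m n G \<le> k"
proof -
  have "relative_clique m n G {}" by (simp add: relative_clique_def)
  then have "{card R | R. relative_clique m n G R} \<noteq> {}" by blast
  then show ?thesis
    unfolding omega_r_def using bound
    by (subst Max_le_iff[OF finite_relative_clique_cards[OF G]]) auto
qed

section \<open>The upper bound\<close>

lemma card_times_minus_Id: "finite D \<Longrightarrow> card (D \<times> D - Id) = card D * (card D - 1)"
proof -
  assume D: "finite D"
  have "D \<times> D - Id = Sigma D (\<lambda>u. D - {u})" by auto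
  then have "card (D \<times> D - Id) = (\<Sum>u\<in>D. card (D - {u}))" using D by simp
  also have "\<dots> = (\<Sum>u\<in>D. card D - 1)" using D by (intro sum.cong) auto
  finally show ?thesis by simp
qed

context
  fixes m n :: nat and G :: mgraph and R :: "nat set"
  assumes G: "colored_mixed_graph m n G" and R: "relative_clique m n G R"
begin

lemma finite_relative_clique: "finite R"
  using finite_subset[OF _ finite_verts[OF G]] R by (simp add: relative_clique_def)

lemma relative_clique_reached:
  assumes "u \<in> R" "v \<in> R" "u \<noteq> v" and agree: "\<And>x. x \<in> X \<Longrightarrow> lab G x u = lab G x v"
  shows "v \<in> reach_avoiding (adj G) X u"
proof -
  have "(u, v) \<in> adj G \<or> (\<exists>w. (u, v) \<in> special_pairs G w)"
    using assms(1-3) R[unfolded relative_clique_iff[OF G]] by blast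
  moreover have "w \<notin> X" "(u, w) \<in> adj G" if "(u, v) \<in> special_pairs G w" for w
    using that agree sym_adj[OF G] by (auto simp: special_pairs_def dest: symD)
  ultimately show ?thesis
    using assms(3) by (auto simp: mem_reach_avoiding_iff special_pairs_def)
qed

context
  assumes K33_free: "K33_minor_free (adj G)"
begin

interpretation K33_minor_free "adj G" by (rule K33_free)

lemma card_same_two_types_le_5:
  assumes "y \<noteq> z"
  shows "card {v \<in> R. lab G y v = Some t \<and> lab G z v = Some s} \<le> 5" (is "card ?C \<le> 5")
proof (rule card_common_neighbours_pairwise_reached_le_5[OF assms])
  show "finite ?C" using finite_relative_clique by simp
  show "?C \<subseteq> adj G `` {y} \<inter> adj G `` {z}" by (auto simp: adj_def)
  show "?C \<subseteq> insert u (reach_avoiding (adj G) {y, z} u)" if "u \<in> ?C" for u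
    using that by (auto intro: relative_clique_reached)
qed

lemma card_same_type_le:
  assumes p: "1 < 2 * m + n"
  shows "card {v \<in> R. lab G y v = Some t} \<le> 5 * (2 * m + n) + 7" (is "card ?Q \<le> _")
proof -
  interpret K33_minor_free_cone "adj G" y ?Q
  proof
    show "finite ?Q" using finite_relative_clique by simp
    show "?Q \<subseteq> adj G `` {y}" by (auto simp: adj_def)
    show "?Q \<subseteq> insert u (reach_avoiding (adj G) {y} u)" if "u \<in> ?Q" for u
      using that by (auto intro: relative_clique_reached)
  qed
  consider "card ?Q \<le> 17" | z where "z \<noteq> y" "?Q \<subseteq> insert z (adj G `` {z})"
    using card_base_le_17_or_second_apex by blast
  then show ?thesis
  proof cases
    case 1
    then show ?thesis using p by arith
  next
    case (2 z)
    let ?C = "\<lambda>s. {v \<in> R. lab G y v = Some t \<and> lab G z v = Some s}"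
    have "?Q \<subseteq> insert z (\<Union>s\<in>adjtypes m n. ?C s)"
    proof
      fix v assume v: "v \<in> ?Q"
      show "v \<in> insert z (\<Union>s\<in>adjtypes m n. ?C s)"
      proof (cases "v = z")
        case False
        then obtain s where "lab G z v = Some s" using 2(2) v by (auto simp: adj_def)
        then show ?thesis using v lab_in_adjtypes[OF G] by auto
      qed simp
    qed
    then have "card ?Q \<le> card (insert z (\<Union>s\<in>adjtypes m n. ?C s))"
      by (intro card_mono) (use finite_relative_clique finite_adjtypes in auto)
    also have "\<dots> \<le> Suc (card (\<Union>s\<in>adjtypes m n. ?C s))"
      using finite_relative_clique by (simp add: card_insert_if finite_adjtypes)
    also have "card (\<Union>s\<in>adjtypes m n. ?C s) \<le> card (adjtypes m n) * 5"
      by (intro card_UN_le_mult finite_adjtypes card_same_two_types_le_5) (use 2 in simp)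
    finally show ?thesis by (simp add: card_adjtypes)
  qed
qed

end

end

lemma card_special_pairs_le:
  assumes G: "colored_mixed_graph m n G" and "finite R"
    and type: "\<And>t. card {v \<in> R. lab G y v = Some t} \<le> a"
  shows "card (Restr (special_pairs G y) R) \<le> card (R \<inter> adj G `` {y}) * ((2 * m + n - 1) * a)"
proof -
  let ?D = "R \<inter> adj G `` {y}"
  define F where "F = (\<lambda>u. {v \<in> ?D. lab G y u \<noteq> lab G y v})"
  have F: "card (F u) \<le> (2 * m + n - 1) * a" if u: "u \<in> ?D" for u
  proof -
    obtain t where t: "lab G y u = Some t" using u by (auto simp: adj_def)
    have "F u \<subseteq> (\<Union>s\<in>adjtypes m n - {t}. {v \<in> R. lab G y v = Some s})"
      using t lab_in_adjtypes[OF G] by (fastforce simp: F_def adj_def)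
    then have "card (F u) \<le> card (\<Union>s\<in>adjtypes m n - {t}. {v \<in> R. lab G y v = Some s})"
      by (intro card_mono) (use \<open>finite R\<close> finite_adjtypes in auto)
    also have "\<dots> \<le> card (adjtypes m n - {t}) * a"
      by (intro card_UN_le_mult type) (simp add: finite_adjtypes)
    finally show ?thesis
      using lab_in_adjtypes[OF G t] by (simp add: card_adjtypes finite_adjtypes)
  qed
  have "Restr (special_pairs G y) R = Sigma ?D F"
    by (auto simp: special_pairs_def F_def)
  then have "card (Restr (special_pairs G y) R) = (\<Sum>u\<in>?D. card (F u))"
    using \<open>finite R\<close> by (simp add: F_def)
  also have "\<dots> \<le> card ?D * ((2 * m + n - 1) * a)"
    using sum_bounded_above[of ?D "\<lambda>u. card (F u)"] F by simp
  finally show ?thesis .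
qed

lemma card_special_pairs_le_square:
  assumes "finite R"
  shows "card (Restr (special_pairs G y) R) \<le>
    card (R \<inter> adj G `` {y}) * (card (R \<inter> adj G `` {y}) - 1)"
proof -
  let ?D = "R \<inter> adj G `` {y}"
  have "card (Restr (special_pairs G y) R) \<le> card (?D \<times> ?D - Id)"
    by (intro card_mono) (use assms in \<open>auto simp: special_pairs_def\<close>)
  then show ?thesis using assms by (simp add: card_times_minus_Id)
qed

context K33_minor_free
begin

lemma card_bipartite_weighted_le:
  assumes fin: "finite R" "finite L" and RL: "R \<inter> L = {}" and ne: "R \<noteq> {}"
  shows "card (Restr E R) + 2 * card (E \<inter> L \<times> R) \<le> 8 * (card R + card L)"
proof -
  let ?F = "Restr E R \<union> (E \<inter> L \<times> R \<union> E \<inter> R \<times> L)"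
  have finite_parts: "finite (Restr E R)" "finite (E \<inter> L \<times> R)" "finite (E \<inter> R \<times> L)"
    using fin by simp_all
  have "(E \<inter> L \<times> R)\<inverse> = E \<inter> R \<times> L" using edge_sym by auto
  then have "card (E \<inter> R \<times> L) = card (E \<inter> L \<times> R)" using card_inverse by metis
  moreover have "card ?F = card (Restr E R) + card (E \<inter> L \<times> R \<union> E \<inter> R \<times> L)"
    by (rule card_Un_disjoint) (use RL finite_parts in auto)
  moreover have "card (E \<inter> L \<times> R \<union> E \<inter> R \<times> L) = card (E \<inter> L \<times> R) + card (E \<inter> R \<times> L)"
    by (rule card_Un_disjoint) (use RL finite_parts in auto)
  moreover interpret F: K33_minor_free ?F
    by (rule K33_minor_free_subgraph) (use edge_sym in \<open>auto simp: sym_def\<close>)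
  have "card ?F + 4 \<le> 8 * card (R \<union> L)"
    by (rule F.card_edges_le) (use fin ne in auto)
  ultimately show ?thesis using card_Un_disjoint[OF fin RL] by simp
qed

lemma card_Y_Delta_le:
  assumes "finite R" "S \<inter> R = {}"
    and leaves: "\<And>s. s \<in> S \<Longrightarrow> card (\<tau> s) \<le> 3" "\<And>s. s \<in> S \<Longrightarrow> \<tau> s \<subseteq> R \<inter> E `` {s}"
  shows "card (Y_Delta E R S \<tau> - Id) \<le> 8 * card R"
proof (cases "R = {}")
  case False
  let ?F = "Y_Delta E R S \<tau>"
  have "sym K33" "K33 O K33 \<inter> K33 = {}"
    by (auto simp: K33_def sym_def)
  moreover have "finite (\<tau> s)" if "s \<in> S" for s
    using finite_subset[OF leaves(2)[OF that]] \<open>finite R\<close> by simp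
  ultimately have "\<not> minor K33 ?F"
    using minor_Y_Delta[OF sym] leaves \<open>S \<inter> R = {}\<close> no_K33_minor by metis
  then interpret F: K33_minor_free "?F - Id"
    using minor_mono[of K33 "?F - Id" ?F] edge_sym
    by unfold_locales (auto simp: Y_Delta_def sym_def irrefl_def)
  have "card (?F - Id) + 4 \<le> 8 * card R"
    by (rule F.card_edges_le) (use \<open>finite R\<close> False in \<open>auto simp: Y_Delta_def\<close>)
  then show ?thesis by simp
qed (simp add: Y_Delta_def)

end

definition triple_cover :: "'a set \<Rightarrow> (3 \<Rightarrow> 'a set) \<Rightarrow> bool" where
  "triple_cover D T \<longleftrightarrow> (\<forall>i. T i \<subseteq> D \<and> card (T i) \<le> 3) \<and> D \<times> D \<subseteq> (\<Union>i. T i \<times> T i)"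

lemma triple_cover_exists:
  assumes "finite D" "card D \<le> 4"
  shows "\<exists>T. triple_cover D T"
proof (cases "card D \<le> 3")
  case True
  then show ?thesis by (intro exI[of _ "\<lambda>_. D"]) (auto simp: triple_cover_def)
next
  case False
  then have "card D = Suc 3" using assms by simp
  then obtain d F where F: "D = insert d F" "card F = 3" by (metis card_eq_SucD)
  then obtain a b c where abc: "F = {a, b, c}" by (auto simp: card_3_iff)
  define T where "T = (\<lambda>i::3. if i = 1 then {a, b, c} else if i = 2 then {b, c, d} else {a, d})"
  have "D \<times> D \<subseteq> T 1 \<times> T 1 \<union> T 2 \<times> T 2 \<union> T 3 \<times> T 3"
    by (auto simp: T_def F abc)
  then have "D \<times> D \<subseteq> (\<Union>i. T i \<times> T i)"
    by blast
  moreover have "T i \<subseteq> D \<and> card (T i) \<le> 3" for i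
    by (auto simp: T_def F abc card_insert_if)
  ultimately show ?thesis unfolding triple_cover_def by blast
qed

context K33_minor_free
begin

lemma card_low_degree_pairs_le:
  assumes R: "finite R" and S: "S \<inter> R = {}" and low: "\<And>s. s \<in> S \<Longrightarrow> card (R \<inter> E `` {s}) \<le> 4"
  shows "card (Y_Delta E R S (\<lambda>s. R \<inter> E `` {s}) - Id) \<le> 24 * card R"
proof -
  let ?D = "\<lambda>s. R \<inter> E `` {s}"
  have "\<exists>T. triple_cover (?D s) T" if "s \<in> S" for s
    by (rule triple_cover_exists) (use low[OF that] R in auto)
  then obtain T where T: "\<And>s. s \<in> S \<Longrightarrow> triple_cover (?D s) (T s)"
    by metis
  define F where "F = (\<lambda>i. Y_Delta E R S (\<lambda>s. T s i) - Id)"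
  have "Y_Delta E R S ?D - Id \<subseteq> (\<Union>i. F i)"
  proof
    fix e assume e: "e \<in> Y_Delta E R S ?D - Id"
    then consider "e \<in> E" | s where "s \<in> S" "e \<in> ?D s \<times> ?D s" unfolding Y_Delta_def by blast
    then show "e \<in> (\<Union>i. F i)"
    proof cases
      case (2 s)
      then obtain i where "e \<in> T s i \<times> T s i" using T[OF 2(1)] unfolding triple_cover_def by blast
      then show ?thesis using e 2(1) unfolding F_def Y_Delta_def by blast
    qed (use e in \<open>auto simp: F_def Y_Delta_def\<close>)
  qed
  then have "card (Y_Delta E R S ?D - Id) \<le> card (\<Union>i. F i)"
    by (intro card_mono) (use R in \<open>auto simp: F_def Y_Delta_def\<close>)
  also have "\<dots> \<le> card (UNIV :: 3 set) * (8 * card R)"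
    unfolding F_def
    by (intro card_UN_le_mult card_Y_Delta_le R S) (use T in \<open>auto simp: triple_cover_def\<close>)
  finally show ?thesis by simp
qed

lemma sum_high_degree_pairs_le:
  fixes c :: "'a \<Rightarrow> nat"
  assumes R: "finite R" "R \<noteq> {}" and L: "finite L" "R \<inter> L = {}"
    and high: "\<And>y. y \<in> L \<Longrightarrow> 5 \<le> card (R \<inter> E `` {y})"
    and c: "\<And>y. c y \<le> card (R \<inter> E `` {y}) * q"
      "\<And>y. c y \<le> card (R \<inter> E `` {y}) * (card (R \<inter> E `` {y}) - 1)"
    and q: "17 \<le> q"
  shows "(\<Sum>y\<in>R \<union> L. c y) \<le> 8 * q * card R"
proof -
  let ?d = "\<lambda>y. card (R \<inter> E `` {y})"
  have sum_d: "(\<Sum>y\<in>X. ?d y) = card (E \<inter> X \<times> R)" if "finite X" for X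
  proof -
    have "E \<inter> X \<times> R = Sigma X (\<lambda>y. R \<inter> E `` {y})" by auto
    then show ?thesis using that R(1) by simp
  qed
  have "c y + 8 * q \<le> 2 * ?d y * q" if "y \<in> L" for y
  proof (cases "8 \<le> ?d y")
    case True
    then have "8 * q \<le> ?d y * q" by (rule mult_right_mono) simp
    moreover have "2 * ?d y * q = ?d y * q + ?d y * q" by simp
    ultimately show ?thesis using c(1)[of y] by linarith
  next
    case False
    then have "?d y = 5 \<or> ?d y = 6 \<or> ?d y = 7" using high[OF that] by linarith
    then show ?thesis using c(2)[of y] q by auto
  qed
  then have "(\<Sum>y\<in>L. c y + 8 * q) \<le> (\<Sum>y\<in>L. 2 * ?d y * q)" by (rule sum_mono)
  then have "(\<Sum>y\<in>L. c y) + 8 * card L * q \<le> 2 * card (E \<inter> L \<times> R) * q"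
    unfolding sum_d[OF L(1), symmetric]
    by (simp add: sum.distrib sum_distrib_left sum_distrib_right mult_ac)
  moreover have "(\<Sum>y\<in>R. c y) \<le> card (Restr E R) * q"
    unfolding sum_d[OF R(1), symmetric] sum_distrib_right by (rule sum_mono) (rule c(1))
  moreover have "(card (Restr E R) + 2 * card (E \<inter> L \<times> R)) * q \<le> 8 * (card R + card L) * q"
    by (intro mult_right_mono card_bipartite_weighted_le R L) simp
  moreover have "(\<Sum>y\<in>R \<union> L. c y) = (\<Sum>y\<in>R. c y) + (\<Sum>y\<in>L. c y)"
    by (rule sum.union_disjoint[OF R(1) L])
  ultimately show ?thesis by (simp add: algebra_simps)
qed

end

lemma relative_clique_pairs_subset:
  fixes R :: "nat set"
  assumes G: "colored_mixed_graph m n G" and R: "relative_clique m n G R"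
    and cover: "verts G \<subseteq> X \<union> S"
  shows "R \<times> R - Id
    \<subseteq> (Y_Delta (adj G) R S (\<lambda>s. R \<inter> adj G `` {s}) - Id) \<union> (\<Union>y\<in>X. Restr (special_pairs G y) R)"
    (is "_ \<subseteq> ?low \<union> ?high")
proof (rule subrelI)
  fix u v assume "(u, v) \<in> R \<times> R - Id"
  then have uv: "u \<in> R" "v \<in> R" "u \<noteq> v" by auto
  then consider "(u, v) \<in> adj G" | w where "(u, v) \<in> special_pairs G w"
    using R[unfolded relative_clique_iff[OF G]] by blast
  then show "(u, v) \<in> ?low \<union> ?high"
  proof cases
    case 1
    then show ?thesis using uv by (simp add: Y_Delta_def)
  next
    case (2 w)
    then have w: "(w, u) \<in> adj G" "(w, v) \<in> adj G" by (auto simp: special_pairs_def)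
    then consider "w \<in> X" | "w \<in> S" using adj_subset_verts[OF G] cover by blast
    then show ?thesis
      by cases (use 2 w uv in \<open>auto simp: Y_Delta_def\<close>)
  qed
qed

theorem relative_clique_card_le:
  assumes G: "colored_mixed_graph m n G" and K33_free: "K33_minor_free (adj G)"
    and R: "relative_clique m n G R"
    and p: "p = 2 * m + n" "1 < p"
  shows "card R \<le> 8 * ((p - 1) * (5 * p + 7)) + 25"
proof (cases "R = {}")
  case False
  interpret K33_minor_free "adj G" by (rule K33_free)
  have finite_R: "finite R" by (rule finite_relative_clique[OF G R])
  let ?D = "\<lambda>y. R \<inter> adj G `` {y}"
  define q where "q = (p - 1) * (5 * p + 7)"
  define L where "L = {s \<in> verts G - R. 5 \<le> card (?D s)}"
  define S where "S = {s \<in> verts G - R. card (?D s) \<le> 4}"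
  let ?low = "Y_Delta (adj G) R S ?D - Id" and ?high = "\<Union>y\<in>R \<union> L. Restr (special_pairs G y) R"
  have finite_L: "finite L" using finite_verts[OF G] by (simp add: L_def)
  have "verts G \<subseteq> (R \<union> L) \<union> S" by (auto simp: L_def S_def)
  then have "card (R \<times> R - Id) \<le> card (?low \<union> ?high)"
    by (intro card_mono relative_clique_pairs_subset[OF G R])
      (use finite_R finite_L in \<open>auto simp: Y_Delta_def\<close>)
  also have "\<dots> \<le> card ?low + card ?high"
    by (rule card_Un_le)
  also have "card ?low \<le> 24 * card R"
    by (rule card_low_degree_pairs_le[OF finite_R]) (auto simp: S_def)
  also have "card ?high \<le> (\<Sum>y\<in>R \<union> L. card (Restr (special_pairs G y) R))"
    by (rule card_UN_le) (use finite_R finite_L in simp)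
  also have "\<dots> \<le> 8 * q * card R"
  proof (rule sum_high_degree_pairs_le[OF finite_R False finite_L])
    show "card (Restr (special_pairs G y) R) \<le> card (?D y) * q" for y
      using card_special_pairs_le[OF G finite_R card_same_type_le[OF G R K33_free]] p
      by (simp add: q_def)
    have "1 * 17 \<le> (p - 1) * (5 * p + 7)" using p(2) by (intro mult_mono) auto
    then show "17 \<le> q" by (simp add: q_def)
    show "card (Restr (special_pairs G y) R) \<le> card (?D y) * (card (?D y) - 1)" for y
      by (rule card_special_pairs_le_square[OF finite_R])
  qed (auto simp: L_def)
  finally have "card R * (card R - 1) \<le> card R * (24 + 8 * q)"
    by (simp add: card_times_minus_Id[OF finite_R] algebra_simps)
  then have "card R - 1 \<le> 24 + 8 * q"
    using False finite_R by (simp add: card_gt_0_iff)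
  then show ?thesis by (simp add: q_def)
qed simp

theorem planar_relative_clique_card_le:
  assumes G: "colored_mixed_graph m n G" and planar: "planar (verts G) (underlying_edges G)"
    and R: "relative_clique m n G R" and p: "p = 2 * m + n" "1 < p"
  shows "card R \<le> 42 * p\<^sup>2 + 8"
proof -
  have "{(u, v). {u, v} \<in> underlying_edges G} = adj G"
    using sym_adj[OF G] by (auto simp: underlying_edges_def adj_def doubleton_eq_iff sym_def)
  then have "K33_minor_free (adj G)"
    using planar_no_K33_minor[OF planar] sym_adj[OF G] irrefl_adj[OF G] by unfold_locales simp_all
  then have "card R \<le> 8 * ((p - 1) * (5 * p + 7)) + 25"
    by (rule relative_clique_card_le[OF G _ R p])
  also have "\<dots> \<le> 42 * p\<^sup>2 + 8"
  proof -
    obtain k where k: "p = k + 2" using p(2) by (metis Suc_1 Suc_leI add.commute le_Suc_ex)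
    have "0 \<le> (int k - 2)\<^sup>2" by simp
    then have "int (8 * k) \<le> int (2 * k\<^sup>2 + 15)" by (simp add: power2_eq_square algebra_simps)
    then have "8 * k \<le> 2 * k\<^sup>2 + 15" by (simp only: of_nat_le_iff)
    then show ?thesis by (simp add: k power2_eq_square algebra_simps)
  qed
  finally show ?thesis .
qed

section \<open>Planar graphs drawn with x-monotone curves\<close>

definition function_graph :: "real \<Rightarrow> real \<Rightarrow> (real \<Rightarrow> real) \<Rightarrow> real \<Rightarrow> real^2" where
  "function_graph a b f = (\<lambda>x. vector [x, f x]) \<circ> linepath a b"

lemma vector_2_eq_iff: "(vector [x, y] :: real^2) = vector [x', y'] \<longleftrightarrow> x = x' \<and> y = y'"
  by (auto simp: vec_eq_iff forall_2)

lemma pathstart_function_graph: "pathstart (function_graph a b f) = vector [a, f a]"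
  and pathfinish_function_graph: "pathfinish (function_graph a b f) = vector [b, f b]"
  by (simp_all add: function_graph_def pathstart_compose pathfinish_compose)

lemma path_image_function_graph:
  "a \<le> b \<Longrightarrow> path_image (function_graph a b f) = (\<lambda>x. vector [x, f x]) ` {a..b}"
  by (simp add: function_graph_def path_image_compose closed_segment_eq_real_ivl1)

lemma arc_function_graph:
  assumes "a < b" "continuous_on {a..b} f"
  shows "arc (function_graph a b f)"
proof -
  have lambda: "(\<lambda>x. vector [x, f x] :: real^2) = (\<lambda>x. \<chi> i. if i = 1 then x else f x)"
    by (simp add: fun_eq_iff vec_eq_iff forall_2)
  have "continuous_on {a..b} (\<lambda>x. if i = 1 then x else f x)" for i :: 2
    using assms(2) by (cases "i = 1") auto
  then have "continuous_on {a..b} (\<lambda>x. vector [x, f x] :: real^2)"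
    unfolding lambda by (rule continuous_on_vec_lambda)
  then have "path (function_graph a b f)"
    unfolding function_graph_def using assms(1)
    by (intro path_continuous_image path_linepath) (simp add: closed_segment_eq_real_ivl1)
  moreover have "inj_on (function_graph a b f) {0..1}"
  proof -
    have "inj_on (linepath a b) {0..1}"
      using arc_linepath[of a b] assms(1) by (simp add: arc_def)
    moreover have "inj (\<lambda>x. vector [x, f x] :: real^2)"
      by (rule injI) (simp add: vector_2_eq_iff)
    ultimately show ?thesis
      unfolding function_graph_def by (intro comp_inj_on) (auto intro: inj_on_subset)
  qed
  ultimately show ?thesis by (simp add: arc_def)
qed

locale x_monotone_drawing =
  fixes N :: nat and C :: "nat rel" and y :: "nat \<Rightarrow> real" and h :: "nat \<Rightarrow> nat \<Rightarrow> real \<Rightarrow> real"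
  assumes chord_less: "(a, b) \<in> C \<Longrightarrow> a < b \<and> b \<le> N"
    and continuous: "(a, b) \<in> C \<Longrightarrow> continuous_on {real a..real b} (h a b)"
    and ends: "(a, b) \<in> C \<Longrightarrow> h a b (real a) = y a \<and> h a b (real b) = y b"
    and vertex_avoiding: "(a, b) \<in> C \<Longrightarrow> a < k \<Longrightarrow> k < b \<Longrightarrow> h a b (real k) \<noteq> y k"
    and noncrossing: "(a, b) \<in> C \<Longrightarrow> (c, d) \<in> C \<Longrightarrow> (a, b) \<noteq> (c, d) \<Longrightarrow>
      x \<in> {real a..real b} \<inter> {real c..real d} \<Longrightarrow> h a b x = h c d x \<Longrightarrow> x \<in> real ` ({a, b} \<inter> {c, d})"
begin

definition vertex_point :: "nat \<Rightarrow> real^2" where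
  "vertex_point k = vector [real k, y k]"

definition edge_curve :: "nat set \<Rightarrow> real \<Rightarrow> real^2" where
  "edge_curve e = function_graph (real (Min e)) (real (Max e)) (h (Min e) (Max e))"

lemma edge_curve_eq: "(a, b) \<in> C \<Longrightarrow> edge_curve {a, b} = function_graph (real a) (real b) (h a b)"
  using chord_less[of a b] by (simp add: edge_curve_def)

lemma path_image_edge_curve:
  "(a, b) \<in> C \<Longrightarrow> path_image (edge_curve {a, b}) = (\<lambda>x. vector [x, h a b x]) ` {real a..real b}"
  using chord_less[of a b] by (simp add: edge_curve_eq path_image_function_graph)

lemma edge_curve_avoids_vertices:
  assumes ab: "(a, b) \<in> C"
  shows "path_image (edge_curve {a, b}) \<inter> range vertex_point \<subseteq> vertex_point ` {a, b}"
proof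
  fix z assume "z \<in> path_image (edge_curve {a, b}) \<inter> range vertex_point"
  then obtain k where k: "z = vertex_point k" "a \<le> k" "k \<le> b" "h a b (real k) = y k"
    unfolding path_image_edge_curve[OF ab] by (auto simp: vertex_point_def vector_2_eq_iff)
  then show "z \<in> vertex_point ` {a, b}" using vertex_avoiding[OF ab, of k] by (auto simp: le_less)
qed

lemma edge_curve_Int_edge_curve:
  assumes ab: "(a, b) \<in> C" and cd: "(c, d) \<in> C" and ne: "{a, b} \<noteq> {c, d}"
  shows "path_image (edge_curve {a, b}) \<inter> path_image (edge_curve {c, d})
    \<subseteq> vertex_point ` ({a, b} \<inter> {c, d})"
proof
  fix z assume "z \<in> path_image (edge_curve {a, b}) \<inter> path_image (edge_curve {c, d})"
  then obtain x where x: "z = vector [x, h a b x]" "x \<in> {real a..real b} \<inter> {real c..real d}"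
    "h a b x = h c d x"
    unfolding path_image_edge_curve[OF ab] path_image_edge_curve[OF cd]
    by (auto simp: vector_2_eq_iff)
  then obtain k where k: "k \<in> {a, b} \<inter> {c, d}" "x = real k"
    using noncrossing[OF ab cd] ne by auto
  then have "h a b x = y k" using ends[OF ab] by auto
  then show "z \<in> vertex_point ` ({a, b} \<inter> {c, d})" using x(1) k by (auto simp: vertex_point_def)
qed

theorem planar_x_monotone_drawing: "planar {0..N} {{a, b} | a b. (a, b) \<in> C}"
proof -
  have "graph_drawing {0..N} {{a, b} | a b. (a, b) \<in> C} vertex_point edge_curve"
  proof
    have "\<exists>u v. u \<noteq> v \<and> u \<in> {0..N} \<and> v \<in> {0..N} \<and> {a, b} = {u, v}" if "(a, b) \<in> C" for a b
      using chord_less[OF that] by (intro exI[of _ a] exI[of _ b]) auto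
    then show "simple_graph {0..N} {{a, b} | a b. (a, b) \<in> C}"
      unfolding simple_graph_def by blast
    show "inj_on vertex_point {0..N}"
      by (rule inj_onI) (simp add: vertex_point_def vector_2_eq_iff)
    fix e assume "e \<in> {{a, b} | a b. (a, b) \<in> C}"
    then obtain a b where e: "e = {a, b}" and ab: "(a, b) \<in> C" by blast
    show "arc (edge_curve e)"
      unfolding e edge_curve_eq[OF ab] using chord_less[OF ab] continuous[OF ab]
      by (intro arc_function_graph) auto
    show "{pathstart (edge_curve e), pathfinish (edge_curve e)} = vertex_point ` e"
      using ends[OF ab]
      by (simp add: e edge_curve_eq[OF ab] vertex_point_def
        pathstart_function_graph pathfinish_function_graph)
    show "path_image (edge_curve e) \<inter> vertex_point ` {0..N} \<subseteq> vertex_point ` e"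
      using edge_curve_avoids_vertices[OF ab] unfolding e by blast
    fix e' assume "e' \<in> {{a, b} | a b. (a, b) \<in> C}" and ne: "e \<noteq> e'"
    then obtain c d where e': "e' = {c, d}" and cd: "(c, d) \<in> C" by blast
    show "path_image (edge_curve e) \<inter> path_image (edge_curve e') \<subseteq> vertex_point ` (e \<inter> e')"
      using edge_curve_Int_edge_curve[OF ab cd] ne unfolding e e' by blast
  qed
  then show ?thesis unfolding planar_iff_graph_drawing by blast
qed

end

lemma nested_parabolas_meet:
  fixes a b c d x :: real
  assumes "a \<le> c" "d \<le> b" "c < d" "(a, b) \<noteq> (c, d)" and x: "c \<le> x" "x \<le> d"
    and eq: "(b - x) * (x - a) = (d - x) * (x - c)"
  shows "x \<in> {a, b} \<inter> {c, d}"
proof -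
  let ?s = "(b - c) * (c - a) * (d - x)" and ?t = "(b - d) * (d - a) * (x - c)"
  have "?s + ?t = (d - c) * ((b - x) * (x - a) - (d - x) * (x - c))"
    by (simp add: algebra_simps)
  then have "?s + ?t = 0" using eq by simp
  moreover have "0 \<le> ?s" "0 \<le> ?t" using assms by simp_all
  ultimately have "?s = 0" "?t = 0" by linarith+
  then show ?thesis using assms by auto
qed

lemma noncrossing_parabolas_meet:
  fixes a b c d x :: real
  assumes "a < b" "c < d" "(a, b) \<noteq> (c, d)" and x: "x \<in> {a..b} \<inter> {c..d}"
    and eq: "(b - x) * (x - a) = (d - x) * (x - c)"
    and noncrossing: "\<not> (a < c \<and> c < b \<and> b < d)" "\<not> (c < a \<and> a < d \<and> d < b)"
  shows "x \<in> {a, b} \<inter> {c, d}"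
proof -
  consider "b \<le> c \<or> d \<le> a" | "a \<le> c" "d \<le> b" | "c \<le> a" "b \<le> d"
    using noncrossing by linarith
  then show ?thesis
  proof cases
    case 1
    then show ?thesis using x assms(1,2) by auto
  next
    case 2
    then show ?thesis using nested_parabolas_meet[of a c d b x] assms by simp
  next
    case 3
    then show ?thesis using nested_parabolas_meet[of c a b d x] assms by auto
  qed
qed

text \<open>The chord from \<open>a\<close> to \<open>b\<close> is the parabola \<open>(b - x) (x - a)\<close> above the axis; the
  apex \<open>0\<close> lies below the axis and is joined by straight lines.\<close>

definition fan_height :: "nat \<Rightarrow> nat \<Rightarrow> real \<Rightarrow> real" where
  "fan_height a b x = (if a = 0 then x / real b - 1 else (real b - x) * (x - real a))"

lemma spoke_Int_chord:
  assumes "1 \<le> k" "c \<noteq> 0" and x: "x \<in> {0..real k} \<inter> {real c..real d}"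
    and eq: "fan_height 0 k x = fan_height c d x"
  shows "x \<in> real ` ({0, k} \<inter> {c, d})"
proof -
  have "fan_height 0 k x \<le> 0" using x assms(1) by (simp add: fan_height_def field_simps)
  moreover have "0 \<le> fan_height c d x" using x assms(2) by (simp add: fan_height_def)
  ultimately have "fan_height 0 k x = 0" "fan_height c d x = 0" using eq by simp_all
  then have "x = real k" "x = real c \<or> x = real d"
    using assms(1,2) by (simp_all add: fan_height_def) auto
  then show ?thesis by auto
qed

lemma fan_curves_meet:
  assumes ab: "a < b" and cd: "c < d" and ne: "(a, b) \<noteq> (c, d)"
    and noncrossing: "\<not> (0 < a \<and> a < c \<and> c < b \<and> b < d)" "\<not> (0 < c \<and> c < a \<and> a < d \<and> d < b)"
    and x: "x \<in> {real a..real b} \<inter> {real c..real d}" and eq: "fan_height a b x = fan_height c d x"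
  shows "x \<in> real ` ({a, b} \<inter> {c, d})"
proof -
  consider "a = 0" "c = 0" | "a = 0" "c \<noteq> 0" | "a \<noteq> 0" "c = 0" | "a \<noteq> 0" "c \<noteq> 0" by blast
  then show ?thesis
  proof cases
    case 1
    then have "x = 0" using eq ne ab cd by (auto simp: fan_height_def field_simps)
    then show ?thesis using 1 by auto
  next
    case 2
    then show ?thesis using spoke_Int_chord[of b c x d] x eq ab by simp
  next
    case 3
    then show ?thesis using spoke_Int_chord[of d a x b] x eq cd by auto
  next
    case 4
    have "x \<in> {real a, real b} \<inter> {real c, real d}"
      by (rule noncrossing_parabolas_meet)
        (use 4 ab cd ne noncrossing x eq in \<open>auto simp: fan_height_def\<close>)
    then show ?thesis by auto
  qed
qed

theorem planar_apex_over_noncrossing_chords: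
  assumes C: "\<And>a b. (a, b) \<in> C \<Longrightarrow> 1 \<le> a \<and> a < b \<and> b \<le> N"
    and noncrossing: "\<And>a b c d. (a, b) \<in> C \<Longrightarrow> (c, d) \<in> C \<Longrightarrow> \<not> (a < c \<and> c < b \<and> b < d)"
  shows "planar {0..N} {{a, b} | a b. (a, b) \<in> {0} \<times> {1..N} \<union> C}"
proof -
  interpret x_monotone_drawing N "{0} \<times> {1..N} \<union> C" "\<lambda>k. if k = 0 then -1 else 0" fan_height
  proof
    fix a b assume ab: "(a, b) \<in> {0} \<times> {1..N} \<union> C"
    then show less: "a < b \<and> b \<le> N"
      using C by force
    show "continuous_on {real a..real b} (fan_height a b)"
      unfolding fan_height_def using less by (cases "a = 0") (auto intro!: continuous_intros)
    show "fan_height a b (real a) = (if a = 0 then -1 else 0)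
      \<and> fan_height a b (real b) = (if b = 0 then -1 else 0)"
      using less by (simp add: fan_height_def)
    show "fan_height a b (real k) \<noteq> (if k = 0 then -1 else 0)" if "a < k" "k < b" for k
      using that by (auto simp: fan_height_def)
    fix c d x assume cd: "(c, d) \<in> {0} \<times> {1..N} \<union> C" and ne: "(a, b) \<noteq> (c, d)"
      and x: "x \<in> {real a..real b} \<inter> {real c..real d}" "fan_height a b x = fan_height c d x"
    have "c < d" using C cd by force
    moreover have "\<not> (0 < a \<and> a < c \<and> c < b \<and> b < d)" "\<not> (0 < c \<and> c < a \<and> a < d \<and> d < b)"
      using noncrossing ab cd by force+
    ultimately show "x \<in> real ` ({a, b} \<inter> {c, d})"
      using fan_curves_meet[of a b c d x] less ne x by blast
  qed
  show ?thesis by (rule planar_x_monotone_drawing)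
qed

section \<open>The lower bound\<close>

definition ordered_mgraph :: "nat \<Rightarrow> (nat \<Rightarrow> nat \<Rightarrow> adjtype option) \<Rightarrow> mgraph" where
  "ordered_mgraph N L = \<lparr>verts = {0..N}, lab = \<lambda>u v.
     if u < v \<and> v \<le> N then L u v else if v < u \<and> u \<le> N then map_option flip_adj (L v u) else None\<rparr>"

lemma verts_ordered_mgraph: "verts (ordered_mgraph N L) = {0..N}"
  by (simp add: ordered_mgraph_def)

lemma lab_ordered_mgraph:
  assumes "u < v" "v \<le> N"
  shows "lab (ordered_mgraph N L) u v = L u v"
    "lab (ordered_mgraph N L) v u = map_option flip_adj (L u v)"
  using assms by (simp_all add: ordered_mgraph_def)

lemma underlying_edges_ordered_mgraph:
  "underlying_edges (ordered_mgraph N L) =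
    {{u, v} | u v. (u, v) \<in> {(u, v). u < v \<and> v \<le> N \<and> L u v \<noteq> None}}"
    (is "_ = ?E")
proof (intro equalityI subsetI)
  fix e assume "e \<in> underlying_edges (ordered_mgraph N L)"
  then obtain u v where e: "e = {u, v}" and "lab (ordered_mgraph N L) u v \<noteq> None"
    unfolding underlying_edges_def by blast
  then consider "u < v" "v \<le> N" "L u v \<noteq> None" | "v < u" "u \<le> N" "L v u \<noteq> None"
    by (auto simp: ordered_mgraph_def split: if_splits)
  then show "e \<in> ?E"
    by cases (use e in \<open>auto simp: insert_commute\<close>)
next
  fix e assume "e \<in> ?E"
  then obtain u v where "e = {u, v}" "u < v" "v \<le> N" "L u v \<noteq> None"
    by blast
  moreover from this have "lab (ordered_mgraph N L) u v \<noteq> None"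
    by (simp add: lab_ordered_mgraph)
  ultimately show "e \<in> underlying_edges (ordered_mgraph N L)"
    unfolding underlying_edges_def by blast
qed

lemma colored_mixed_graph_ordered_mgraph:
  assumes types: "\<And>u v t. u < v \<Longrightarrow> v \<le> N \<Longrightarrow> L u v = Some t \<Longrightarrow> t \<in> adjtypes m n"
  shows "colored_mixed_graph m n (ordered_mgraph N L)"
  unfolding colored_mixed_graph_iff
proof (intro conjI allI impI)
  show "finite (verts (ordered_mgraph N L))" by (simp add: verts_ordered_mgraph)
  show "adj (ordered_mgraph N L) \<subseteq> verts (ordered_mgraph N L) \<times> verts (ordered_mgraph N L)"
    by (auto simp: adj_def ordered_mgraph_def split: if_splits)
  show "irrefl (adj (ordered_mgraph N L))"
    by (simp add: irrefl_def adj_def ordered_mgraph_def)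
  fix u v
  show "lab (ordered_mgraph N L) v u = map_option flip_adj (lab (ordered_mgraph N L) u v)"
    by (auto simp: ordered_mgraph_def option.map_comp comp_def option.map_ident)
  fix t assume "lab (ordered_mgraph N L) u v = Some t"
  then show "t \<in> adjtypes m n"
    using types[of u v t] types[of v u]
    by (auto simp: ordered_mgraph_def flip_adj_in_adjtypes split: if_splits)
qed

lemma div_3_eq_cases:
  fixes x d :: nat
  assumes "x div 3 = (x + d) div 3" "1 \<le> d"
  shows "d = 1 \<and> Suc x mod 3 \<noteq> 0 \<or> d = 2 \<and> Suc x mod 3 = 1"
proof -
  have "x mod 3 + d = (x + d) mod 3"
    using assms(1) div_mult_mod_eq[of x 3] div_mult_mod_eq[of "x + d" 3] by linarith
  moreover have "(x + d) mod 3 < 3"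
    by simp
  ultimately consider "d = 1" "x mod 3 < 2" | "d = 2" "x mod 3 = 0"
    using assms(2) by linarith
  then show ?thesis
    by cases (auto simp: mod_Suc)
qed

text \<open>The apex \<open>0\<close> is joined to the vertices \<open>1, \<dots>, p (3 p + 1)\<close>, which form \<open>p\<close> consecutive blocks.
  The first vertex of a block sends each type to three consecutive vertices, a path whose ends form
  a special pair.\<close>

context
  fixes p :: nat and \<tau> :: "nat \<Rightarrow> adjtype"
begin

definition block :: "nat \<Rightarrow> nat" where
  "block v = (v - 1) div (3 * p + 1)"

definition position :: "nat \<Rightarrow> nat" where
  "position v = (v - 1) mod (3 * p + 1)"

definition fan_lab :: "nat \<Rightarrow> nat \<Rightarrow> adjtype option" where
  "fan_lab u v =
    (if u = 0 then Some (\<tau> (block v))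
     else if block u \<noteq> block v then None
     else if position u = 0 then Some (\<tau> ((position v - 1) div 3))
     else if v \<noteq> u + 1 \<or> position u mod 3 = 0 then None
     else Some (if position u mod 3 = 1 then flip_adj (\<tau> 0) else \<tau> 1))"

definition fan_graph :: mgraph where
  "fan_graph = ordered_mgraph (p * (3 * p + 1)) fan_lab"

definition hub :: "nat \<Rightarrow> nat" where
  "hub b = b * (3 * p + 1) + 1"

lemma vertex_eq_hub_plus_position: "1 \<le> v \<Longrightarrow> v = hub (block v) + position v"
  using div_mult_mod_eq[of "v - 1" "3 * p + 1"] by (simp add: block_def position_def hub_def)

lemma block_hub: "block (hub b) = b"
  unfolding block_def hub_def add_diff_cancel_right' by (rule nonzero_mult_div_cancel_right) simp

lemma position_hub: "position (hub b) = 0"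
  unfolding position_def hub_def add_diff_cancel_right' by (rule mod_mult_self2_is_0)

lemma position_le: "position v \<le> 3 * p"
proof -
  have "position v < 3 * p + 1" unfolding position_def by (rule mod_less_divisor) simp
  then show ?thesis by simp
qed

lemma block_less: "1 \<le> v \<Longrightarrow> v \<le> p * (3 * p + 1) \<Longrightarrow> block v < p"
  unfolding block_def by (subst div_less_iff_less_mult) auto

lemma block_mono: "u \<le> v \<Longrightarrow> block u \<le> block v"
  unfolding block_def by (intro div_le_mono) simp

lemma same_block_between: "u \<le> w \<Longrightarrow> w \<le> v \<Longrightarrow> block u = block v \<Longrightarrow> block w = block u"
  using block_mono[of u w] block_mono[of w v] by simp

lemma position_add:
  assumes "1 \<le> u" "u \<le> v" "block u = block v"
  shows "position v = position u + (v - u)"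
  using vertex_eq_hub_plus_position[of u] vertex_eq_hub_plus_position[of v] assms by simp

lemma planar_fan_graph: "planar (verts fan_graph) (underlying_edges fan_graph)"
proof -
  define N where "N = p * (3 * p + 1)"
  define C where "C = {(u, v). 1 \<le> u \<and> u < v \<and> v \<le> N \<and> fan_lab u v \<noteq> None}"
  have C: "1 \<le> u \<and> u < v \<and> v \<le> N" "block u = block v" "position u = 0 \<or> v = u + 1"
    if "(u, v) \<in> C" for u v
    using that by (auto simp: C_def fan_lab_def split: if_splits)
  have "\<not> (a < c \<and> c < b \<and> b < d)" if ab: "(a, b) \<in> C" and cd: "(c, d) \<in> C" for a b c d
  proof
    assume less: "a < c \<and> c < b \<and> b < d"
    then have "position a = 0" "position c = 0" using C(3)[OF ab] C(3)[OF cd] by auto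
    moreover have "block c = block a"
      using same_block_between[of a c b] less C(2)[OF ab] by simp
    then have "position c = position a + (c - a)"
      using position_add[of a c] less C(1)[OF ab] by simp
    ultimately show False using less by simp
  qed
  then have "planar {0..N} {{u, v} | u v. (u, v) \<in> {0} \<times> {1..N} \<union> C}"
    by (intro planar_apex_over_noncrossing_chords) (use C(1) in blast)+
  moreover have "{0} \<times> {1..N} \<union> C = {(u, v). u < v \<and> v \<le> N \<and> fan_lab u v \<noteq> None}"
  proof -
    have "\<exists>t. fan_lab 0 v = Some t" for v by (simp add: fan_lab_def)
    then show ?thesis by (fastforce simp: C_def not_less_eq_eq)
  qed
  ultimately show ?thesis
    unfolding fan_graph_def N_def[symmetric] underlying_edges_ordered_mgraph verts_ordered_mgraph
    by (simp only:)
qed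

context
  fixes m n :: nat
  assumes p: "1 < p" and \<tau>: "bij_betw \<tau> {..<p} (adjtypes m n)"
begin

lemma colored_mixed_graph_fan_graph: "colored_mixed_graph m n fan_graph"
  unfolding fan_graph_def
proof (rule colored_mixed_graph_ordered_mgraph)
  have type: "\<tau> i \<in> adjtypes m n" if "i < p" for i
    using \<tau> that by (auto dest: bij_betwE)
  fix u v t assume uv: "u < v" "v \<le> p * (3 * p + 1)" "fan_lab u v = Some t"
  have "block v < p" using uv by (intro block_less) auto
  moreover have "(position v - 1) div 3 < p"
    using position_le[of v] p by (subst div_less_iff_less_mult) auto
  ultimately show "t \<in> adjtypes m n"
    using uv(3) p type by (auto simp: fan_lab_def flip_adj_in_adjtypes split: if_splits)
qed

lemma \<tau>_eq_iff: "i < p \<Longrightarrow> j < p \<Longrightarrow> \<tau> i = \<tau> j \<longleftrightarrow> i = j"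
  using \<tau> by (auto simp: bij_betw_def inj_on_def)

lemma same_triple_joined:
  assumes uv: "1 \<le> u" "u < v" "v \<le> p * (3 * p + 1)" "block u = block v" "1 \<le> position u"
    and triple: "(position u - 1) div 3 = (position v - 1) div 3"
  shows "(u, v) \<in> adj fan_graph \<or> (u, v) \<in> special_pairs fan_graph (u + 1)"
proof -
  obtain x where x: "position u = Suc x"
    using uv(5) by (cases "position u") auto
  have "position v = Suc x + (v - u)"
    using position_add[of u v] uv x by simp
  then have "v - u = 1 \<and> Suc x mod 3 \<noteq> 0 \<or> v - u = 2 \<and> Suc x mod 3 = 1"
    by (intro div_3_eq_cases) (use triple uv(2) x in simp_all)
  then consider "v = u + 1" "position u mod 3 \<noteq> 0" | "v = u + 2" "position u mod 3 = 1"
    using uv(2) x by force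
  then show ?thesis
  proof cases
    case 1
    then have "fan_lab u v \<noteq> None" using uv by (simp add: fan_lab_def)
    then show ?thesis using lab_ordered_mgraph(1)[of u v] uv by (simp add: fan_graph_def adj_def)
  next
    case 2
    let ?w = "u + 1"
    have w: "block ?w = block u" using same_block_between[of u ?w v] uv 2 by simp
    then have "position ?w = position u + 1" using position_add[of u ?w] uv by simp
    then have "fan_lab u ?w = Some (flip_adj (\<tau> 0))" "fan_lab ?w v = Some (\<tau> 1)"
      using uv 2 w by (simp_all add: fan_lab_def mod_Suc)
    then have "lab fan_graph ?w u = Some (\<tau> 0)" "lab fan_graph ?w v = Some (\<tau> 1)"
      using lab_ordered_mgraph(2)[of u ?w] lab_ordered_mgraph(1)[of ?w v] uv 2
      by (simp_all add: fan_graph_def)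
    then show ?thesis using \<tau>_eq_iff[of 0 1] p by (simp add: special_pairs_def adj_def)
  qed
qed

lemma fan_graph_joined:
  assumes uv: "u < v" "v \<le> p * (3 * p + 1)"
  shows "(u, v) \<in> adj fan_graph \<or> (\<exists>w. (u, v) \<in> special_pairs fan_graph w)"
proof -
  have lab: "lab fan_graph a b = fan_lab a b" if "a < b" "b \<le> p * (3 * p + 1)" for a b
    using that by (simp add: fan_graph_def lab_ordered_mgraph)
  have special: "(u, v) \<in> special_pairs fan_graph w"
    if "w < u" "fan_lab w u = Some (\<tau> i)" "fan_lab w v = Some (\<tau> j)"
      "i < p" "j < p" "i \<noteq> j" for w i j
    using that uv \<tau>_eq_iff by (simp add: special_pairs_def adj_def lab)
  consider "u = 0 \<or> block u = block v \<and> position u = 0" | "1 \<le> u" "block u \<noteq> block v"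
    | "1 \<le> u" "block u = block v" "1 \<le> position u" "(position u - 1) div 3 \<noteq> (position v - 1) div 3"
    | "1 \<le> u" "block u = block v" "1 \<le> position u" "(position u - 1) div 3 = (position v - 1) div 3"
    by linarith
  then show ?thesis
  proof cases
    case 1
    then have "fan_lab u v \<noteq> None" by (auto simp: fan_lab_def)
    then show ?thesis using uv by (simp add: adj_def lab)
  next
    case 2
    then have "(u, v) \<in> special_pairs fan_graph 0"
      using uv by (intro special[of 0 "block u" "block v"] block_less) (auto simp: fan_lab_def)
    then show ?thesis by blast
  next
    case 3
    have w: "1 \<le> hub (block u)" "hub (block u) < u"
      using vertex_eq_hub_plus_position[OF 3(1)] 3(3) by (simp_all add: hub_def)
    have "(position u - 1) div 3 < p" "(position v - 1) div 3 < p"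
      using position_le[of u] position_le[of v] p by (auto simp: div_less_iff_less_mult)
    then have "(u, v) \<in> special_pairs fan_graph (hub (block u))"
      using w 3 by (intro special) (auto simp: fan_lab_def block_hub position_hub)
    then show ?thesis by blast
  next
    case 4
    then show ?thesis using same_triple_joined[of u v] uv by blast
  qed
qed

theorem relative_clique_fan_graph: "relative_clique m n fan_graph (verts fan_graph)"
  unfolding relative_clique_iff[OF colored_mixed_graph_fan_graph]
proof
  show "verts fan_graph \<times> verts fan_graph \<subseteq> Id \<union> adj fan_graph \<union> (\<Union>w. special_pairs fan_graph w)"
  proof clarify
    fix u v assume uv: "u \<in> verts fan_graph" "v \<in> verts fan_graph" "(u, v) \<notin> adj fan_graph"
      "(u, v) \<notin> (\<Union>w. special_pairs fan_graph w)"
    have "(v, u) \<notin> adj fan_graph" "(v, u) \<notin> special_pairs fan_graph w" for w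
      using uv(3,4) sym_adj[OF colored_mixed_graph_fan_graph]
      by (auto simp: special_pairs_def dest: symD)
    then show "u = v"
      using fan_graph_joined[of u v] fan_graph_joined[of v u] uv
      by (cases u v rule: linorder_cases) (auto simp: fan_graph_def verts_ordered_mgraph)
  qed
qed simp

end

end

theorem exists_planar_relative_clique:
  assumes p: "p = 2 * m + n" "1 < p"
  obtains G where "colored_mixed_graph m n G" "planar (verts G) (underlying_edges G)"
    "relative_clique m n G (verts G)" "card (verts G) = 3 * p\<^sup>2 + p + 1"
proof -
  obtain \<tau> where \<tau>: "bij_betw \<tau> {..<p} (adjtypes m n)"
    using ex_bij_betw_nat_finite[OF finite_adjtypes]
    by (auto simp: card_adjtypes p(1) lessThan_atLeast0)
  have "card (verts (fan_graph p \<tau>)) = 3 * p\<^sup>2 + p + 1"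
    by (simp add: fan_graph_def verts_ordered_mgraph power2_eq_square algebra_simps)
  then show thesis
    using that colored_mixed_graph_fan_graph planar_fan_graph relative_clique_fan_graph p(2) \<tau>
    by blast
qed

theorem mainTheorem4:
  fixes m n p :: nat
  assumes "p = 2 * m + n" and "p > 1"
  shows "enat (3 * p^2 + p + 1) \<le> omega_r_planar m n \<and> omega_r_planar m n \<le> enat (42 * p^2 + 8)"
proof
  obtain G where G: "colored_mixed_graph m n G" "planar (verts G) (underlying_edges G)"
    and clique: "relative_clique m n G (verts G)" "card (verts G) = 3 * p\<^sup>2 + p + 1"
    using exists_planar_relative_clique[OF assms] .
  then have "enat (3 * p^2 + p + 1) \<le> enat (omega_r m n G)"
    using card_le_omega_r[OF G(1) clique(1)] by simp
  also have "\<dots> \<le> omega_r_planar m n"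
    unfolding omega_r_planar_def using G by (intro SUP_upper) simp
  finally show "enat (3 * p^2 + p + 1) \<le> omega_r_planar m n" .
  show "omega_r_planar m n \<le> enat (42 * p^2 + 8)"
  proof -
    have "omega_r m n G \<le> 42 * p^2 + 8"
      if "colored_mixed_graph m n G" "planar (verts G) (underlying_edges G)" for G
      using that planar_relative_clique_card_le[OF _ _ _ assms] by (intro omega_r_le)
    then show ?thesis
      unfolding omega_r_planar_def by (intro SUP_least) simp
  qed
qed

end
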